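(* Let $\mathbf{x}=(x_1,\dots,x_k)$ be a fixed vector of positive integers, not all equal to $1$, and let $r=\sum_{i=1}^k x_i$. Then \[ m(\mathbf{x},n)\geq\frac{4kr+1}{4kr}\left(\frac{1}{c(\mathbf{x})\,x_1!x_2!\cdots x_k!}+o(1)\right)n^{r-k}, \] where $c(\mathbf{x})$ is the number of unordered partitions of an $r$-set into $k$ sets of sizes $x_1,x_2,\dots,x_k$, and $o(1)$ denotes a quantity tending to $0$ as $n\to\infty$ with $\mathbf{x}$ fixed.
   Context: $[n]=\{1,\dots,n\}$ and $[n]^{(r)}$ is the family of all $r$-element subsets of $[n]$. A Hamilton cycle in $K_n$ (on vertex set $[n]$) is regarded as a cyclic ordering $c_1,c_2,\dots,c_n$ of $[n]$, with indices taken modulo $n$. For $\mathbf{x}=(x_1,\dots,x_k)$ a vector of positive integers with $\sum_i x_i=r$ and a family $\mathcal{F}\subseteq[n]^{(r)}$, a Hamilton cycle $c_1,\dots,c_n$ is called $\mathbf{x}$-acceptable for (or with respect to) $\mathcal{F}$ if there do not exist $t_1,\dots,t_k$ with $\bigcup_{i=1}^k\{c_{t_i+1},c_{t_i+2},\dots,c_{t_i+x_i}\}\in\mathcal{F}$. Then $m(\mathbf{x},n)$ (for $n\ge r$) denotes the minimum of $|\mathcal{F}|$ over all families $\mathcal{F}\subseteq[n]^{(r)}$ such that $K_n$ does not contain an $\mathbf{x}$-acceptable Hamilton cycle with respect to $\mathcal{F}$. *)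

theory Defs
  imports Complex_Main "HOL-Library.Multiset" "HOL-Library.Disjoint_Sets" "HOL-Library.Ramsey"
begin

text \<open>
  A Hamilton cycle of the complete graph on \<open>{1..n}\<close> is given by a cyclic ordering \<open>c\<close> of its
  vertices. Indices are residues modulo \<open>n\<close>, represented in \<open>{..<n}\<close>, so that the vertex usually
  written \<open>c_n\<close> is \<open>c 0\<close>.
\<close>

definition hamilton_cycle :: "nat \<Rightarrow> (nat \<Rightarrow> nat) \<Rightarrow> bool" where
  "hamilton_cycle n c \<longleftrightarrow> bij_betw c {..<n} {1..n}"

definition cyclic_interval :: "nat \<Rightarrow> (nat \<Rightarrow> nat) \<Rightarrow> nat \<Rightarrow> nat \<Rightarrow> nat set" where
  "cyclic_interval n c t l = (\<lambda>j. c ((t + j) mod n)) ` {1..l}"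

text \<open>
  The intervals are not required to be disjoint: this is automatic when their union lies in a
  family of sets of size \<open>sum_list x\<close>.
\<close>

definition acceptable :: "nat list \<Rightarrow> nat \<Rightarrow> nat set set \<Rightarrow> (nat \<Rightarrow> nat) \<Rightarrow> bool" where
  "acceptable x n F c \<longleftrightarrow>
     \<not> (\<exists>t :: nat \<Rightarrow> nat. (\<Union>i<length x. cyclic_interval n c (t i) (x ! i)) \<in> F)"

text \<open>
  For \<open>n \<ge> sum_list x\<close> the set below is nonempty, since the family of all subsets of size
  \<open>sum_list x\<close> admits no acceptable Hamilton cycle; its infimum is therefore a minimum.
\<close>

definition min_blocking :: "nat list \<Rightarrow> nat \<Rightarrow> nat" where
  "min_blocking x n =
     Inf {card F |F. F \<subseteq> nsets {1..n} (sum_list x) \<and>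
                     \<not> (\<exists>c. hamilton_cycle n c \<and> acceptable x n F c)}"

definition num_partitions :: "nat list \<Rightarrow> nat" where
  "num_partitions x =
     card {P. partition_on {1..sum_list x} P \<and> image_mset card (mset_set P) = mset x}"

end

theory Submission
  imports Defs "HOL-Combinatorics.Multiset_Permutations"
begin

text \<open>
  Let \<open>s\<close> be the number of permutations of the indices that preserve \<open>x\<close>, and let \<open>F\<close> be a family for
  which no Hamilton cycle is acceptable. There are about \<open>n\<^sup>k\<close> tuples of starting points, and a fixed
  tuple whose intervals are disjoint turns a uniformly random cycle into a uniformly random \<open>r\<close>-set.
  So the number \<open>N\<close> of tuples that hit \<open>F\<close> along a random cycle has expectation about
  \<open>n\<^sup>k * card F / (n choose r)\<close>. On the other hand every cycle is hit, and each member of \<open>F\<close> that is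
  hit by a well-separated tuple is hit by at least \<open>s\<close> of them. Hence \<open>N \<ge> s\<close> apart from degenerate tuples, of
  which there are only \<open>O(n\<^bsup>k - 1\<^esup>)\<close>. Since \<open>c(x) * s * \<Prod>i. (x ! i)! \<ge> r!\<close>
  (\<open>fact_le_num_partitions\<close>), this yields the bound without the factor \<open>(4 k r + 1) / (4 k r)\<close>.

  The factor is gained by showing that not almost all cycles can contain a single member of \<open>F\<close>.
  Suppose that \<open>C\<close> contains just one member \<open>B\<close> of \<open>F\<close>. Fix a block of length at least \<open>2\<close>, and swap
  its first vertex with the vertex in front of it. The new cycle must contain some member
  \<open>B'\<close> of \<open>F\<close>, and \<open>B'\<close> contains exactly one of the two swapped vertices. It turns out that one of two rotations
  of a short window of \<open>C\<close> gives a cycle in which \<open>B\<close> and \<open>B'\<close> are both visible (\<open>second_blocks\<close>).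
  As both rotations are injective, the cycles with a single member of \<open>F\<close> contribute at
  most twice as much to the sum of \<open>N\<close> over all cycles as the cycles with several members, up to degenerate
  tuples (\<open>card_regular_hits_le\<close>). A short computation then shows that the expectation of \<open>N\<close> is
  at least \<open>6 / 5 * s\<close> asymptotically (\<open>card_hits_total_ge\<close>, \<open>card_family_ge\<close>). This suffices because
  \<open>k \<ge> 1\<close> and \<open>r \<ge> 2\<close> imply \<open>(4 k r + 1) / (4 k r) \<le> 9 / 8\<close>.
\<close>

section \<open>Hamilton cycles as periodic functions\<close>

text \<open>
  A Hamilton cycle on \<open>{1..n}\<close>, encoded as an \<open>n\<close>-periodic function on the integers, so that
  intervals of consecutive vertices are images of integer intervals and never wrap around.
\<close>
definition cycles :: "nat \<Rightarrow> (int \<Rightarrow> nat) set" where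
  "cycles n = {C. range C = {1..n} \<and> (\<forall>y z. C y = C z \<longleftrightarrow> y mod int n = z mod int n)}"

text \<open>
  The union of the vertex intervals of lengths \<open>x ! i\<close> that start right after the positions \<open>t i\<close>.
  Only the residues of the \<open>t i\<close> modulo \<open>n\<close> matter.
\<close>
definition blocks :: "nat list \<Rightarrow> (int \<Rightarrow> nat) \<Rightarrow> (nat \<Rightarrow> int) \<Rightarrow> nat set" where
  "blocks x C t = (\<Union>i<length x. C ` {t i + 1..t i + int (x ! i)})"

text \<open>
  The entries \<open>t 0, \<dots>, t (k - 1)\<close> are pairwise at cyclic distance more than \<open>D\<close> modulo \<open>n\<close>.
\<close>
definition separated :: "nat \<Rightarrow> nat \<Rightarrow> int \<Rightarrow> (nat \<Rightarrow> int) \<Rightarrow> bool" where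
  "separated n k D t \<longleftrightarrow>
     (\<forall>i<k. \<forall>j<k. i \<noteq> j \<longrightarrow> (\<forall>e. \<bar>e\<bar> \<le> D \<longrightarrow> \<not> int n dvd t i - t j - e))"

text \<open>
  The permutation of positions that rotates the window \<open>q, \<dots>, q + l\<close> (and its translates by
  multiples of \<open>n\<close>) by one step and fixes everything else. Composing a cycle \<open>C\<close> with it moves the
  vertex \<open>C q\<close> to the end of the window and shifts the other \<open>l\<close> vertices one place to the left. For
  \<open>l = 1\<close> it swaps two neighbours.
\<close>
definition rot :: "nat \<Rightarrow> int \<Rightarrow> int \<Rightarrow> int \<Rightarrow> int" where
  "rot n q l z =
     (if (z - q) mod int n < l then z + 1 else if (z - q) mod int n = l then z - l else z)"

lemma rot_low:
  assumes "q \<le> z" "z < q + l" "l < int n"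
  shows "rot n q l z = z + 1"
  using assms by (simp add: rot_def mod_pos_pos_trivial)

lemma rot_top:
  assumes "0 \<le> l" "l < int n"
  shows "rot n q l (q + l) = q"
  using assms by (simp add: rot_def mod_pos_pos_trivial)

lemma rot_outside:
  assumes "0 < n" "\<And>e. 0 \<le> e \<Longrightarrow> e \<le> l \<Longrightarrow> \<not> int n dvd z - q - e"
  shows "rot n q l z = z"
proof -
  have "int n dvd z - q - (z - q) mod int n" by (simp add: dvd_minus_mod)
  with assms have "\<not> (z - q) mod int n \<le> l"
    by (metis of_nat_0_less_iff pos_mod_sign)
  then show ?thesis by (simp add: rot_def)
qed

lemma rot_residue:
  assumes "0 \<le> l" "l < int n"
  shows "(rot n q l z - q) mod int n =
    (let e = (z - q) mod int n in if e < l then e + 1 else if e = l then 0 else e)"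
proof -
  define e where "e = (z - q) mod int n"
  have 1: "(z + 1 - q) mod int n = (e + 1) mod int n"
    unfolding e_def by (simp add: mod_simps algebra_simps)
  have 2: "(z - l - q) mod int n = (e - l) mod int n"
    unfolding e_def by (simp add: mod_simps algebra_simps)
  have "0 \<le> e" "e < int n" using assms by (auto simp: e_def)
  then show ?thesis using assms 1 2 by (simp add: rot_def Let_def e_def[symmetric])
qed

lemma rot_mod_eq_iff:
  assumes "0 \<le> l" "l < int n"
  shows "rot n q l y mod int n = rot n q l z mod int n \<longleftrightarrow> y mod int n = z mod int n"
proof -
  have sh: "a mod int n = b mod int n \<longleftrightarrow> (a - q) mod int n = (b - q) mod int n" for a b
    by (simp add: mod_eq_dvd_iff)
  have "0 \<le> (y - q) mod int n" "0 \<le> (z - q) mod int n" using assms by simp_all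
  then show ?thesis
    unfolding sh[of "rot n q l y"] sh[of y] rot_residue[OF assms] Let_def
    by (simp split: if_splits)
qed

lemma surj_rot:
  assumes "0 \<le> l" "l < int n"
  shows "surj (rot n q l)"
proof -
  have "\<exists>z. y = rot n q l z" for y
  proof -
    define e where "e = (y - q) mod int n"
    have e: "0 \<le> e" "e < int n" using assms by (auto simp: e_def)
    have 1: "(y - 1 - q) mod int n = (e - 1) mod int n"
      unfolding e_def by (simp add: mod_simps algebra_simps)
    have 2: "(y + l - q) mod int n = (e + l) mod int n"
      unfolding e_def by (simp add: mod_simps algebra_simps)
    consider "e = 0" | "1 \<le> e" "e \<le> l" | "l < e" using e by linarith
    then show ?thesis
    proof cases
      case 1
      then have "rot n q l (y + l) = y" using 2 assms by (simp add: rot_def)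
      then show ?thesis by metis
    next
      case 2
      then have "rot n q l (y - 1) = y" using 1 e by (simp add: rot_def)
      then show ?thesis by metis
    next
      case 3
      then have "rot n q l y = y" by (simp add: rot_def e_def[symmetric])
      then show ?thesis by metis
    qed
  qed
  then show ?thesis by (simp add: surj_def)
qed

lemma comp_rot_in_cycles:
  assumes "C \<in> cycles n" "0 \<le> l" "l < int n"
  shows "C \<circ> rot n q l \<in> cycles n"
proof -
  have "range (C \<circ> rot n q l) = range C"
    using surj_rot[OF assms(2,3)] by (metis image_comp)
  then show ?thesis
    using assms rot_mod_eq_iff[OF assms(2,3)] by (auto simp: cycles_def)
qed

lemma comp_rot_inject:
  assumes "C \<circ> rot n q l = C' \<circ> rot n q l" "0 \<le> l" "l < int n"
  shows "C = C'"
  using assms surj_rot[OF assms(2,3), of q] by (metis surj_fun_eq)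

lemma cycles_eq_iff: "C \<in> cycles n \<Longrightarrow> C y = C z \<longleftrightarrow> int n dvd y - z"
  by (simp add: cycles_def mod_eq_dvd_iff)

lemma finite_cycles: "finite (cycles n)"
proof (cases "n = 0")
  case False
  have "cycles n \<subseteq> (\<lambda>f z. f (z mod int n)) ` ({0..<int n} \<rightarrow>\<^sub>E {1..n})"
  proof
    fix C assume C: "C \<in> cycles n"
    have "C = (\<lambda>z. restrict C {0..<int n} (z mod int n))"
      using C False by (auto simp: cycles_def fun_eq_iff)
    moreover have "restrict C {0..<int n} \<in> {0..<int n} \<rightarrow>\<^sub>E {1..n}"
      using C by (auto simp: cycles_def)
    ultimately show "C \<in> (\<lambda>f z. f (z mod int n)) ` ({0..<int n} \<rightarrow>\<^sub>E {1..n})" by blast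
  qed
  then show ?thesis by (meson finite_PiE finite_atLeastAtMost finite_atLeastLessThan_int finite_imageI finite_subset)
qed (auto simp: cycles_def)

lemma cycles_nonempty: "cycles n \<noteq> {}" if "0 < n"
proof -
  have "(\<lambda>z. Suc (nat (z mod int n))) \<in> cycles n"
  proof -
    have "y \<in> range (\<lambda>z. Suc (nat (z mod int n)))" if "1 \<le> y" "y \<le> n" for y
      using that by (intro image_eqI[of _ _ "int y - 1"]) auto
    moreover have "Suc (nat (z mod int n)) \<le> n" for z
    proof -
      have "z mod int n < int n" using that by simp
      then show ?thesis using that by linarith
    qed
    ultimately show ?thesis using that
      by (auto simp: cycles_def eq_nat_nat_iff)
  qed
  then show ?thesis by blast
qed

lemma hamilton_cycle_of_cycles:
  assumes "C \<in> cycles n" "0 < n"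
  shows "hamilton_cycle n (\<lambda>i. C (int i))"
proof -
  have "y \<in> (\<lambda>i. C (int i)) ` {..<n}" if y: "y \<in> {1..n}" for y
  proof -
    have "y \<in> range C" using assms y by (simp add: cycles_def)
    then obtain z where "y = C z" by blast
    then have "y = C (z mod int n)" using assms by (auto simp: cycles_def)
    then show ?thesis using assms(2) by (intro image_eqI[of _ _ "nat (z mod int n)"]) (auto simp: nat_less_iff)
  qed
  moreover have "C z \<in> {1..n}" for z using assms by (auto simp: cycles_def)
  ultimately show ?thesis using assms
    unfolding hamilton_cycle_def bij_betw_def inj_on_def 
    by (auto simp: cycles_def)
qed

lemma cyclic_interval_of_cycles:
  assumes "C \<in> cycles n"
  shows "cyclic_interval n (\<lambda>i. C (int i)) t l = C ` {int t + 1..int t + int l}"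
proof -
  have "C (int ((t + j) mod n)) = C (int t + int j)" for j
    using assms by (simp add: cycles_def zmod_int)
  then have "cyclic_interval n (\<lambda>i. C (int i)) t l = C ` ((\<lambda>j. int t + int j) ` {1..l})"
    by (auto simp: cyclic_interval_def image_image)
  also have "(\<lambda>j. int t + int j) ` {1..l} = {int t + 1..int t + int l}"
  proof -
    have "z \<in> (\<lambda>j. int t + int j) ` {1..l}" if "z \<in> {int t + 1..int t + int l}" for z
      using that by (intro image_eqI[of _ _ "nat (z - int t)"]) auto
    then show ?thesis by auto
  qed
  finally show ?thesis .
qed

section \<open>A second blocking set after a local rotation\<close>

text \<open>The union of all intervals but the \<open>j\<close>-th.\<close>
definition other_blocks :: "nat list \<Rightarrow> (int \<Rightarrow> nat) \<Rightarrow> (nat \<Rightarrow> int) \<Rightarrow> nat \<Rightarrow> nat set" where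
  "other_blocks x C t j = (\<Union>i\<in>{..<length x} - {j}. C ` {t i + 1..t i + int (x ! i)})"

lemma blocks_eq_Un:
  "j < length x \<Longrightarrow> blocks x C t = C ` {t j + 1..t j + int (x ! j)} \<union> other_blocks x C t j"
  by (auto simp: blocks_def other_blocks_def)

lemma other_blocks_upd [simp]: "other_blocks x C (t(j := v)) j = other_blocks x C t j"
  by (auto simp: other_blocks_def)

lemma not_dvd_small: "\<not> int n dvd z" if "z \<noteq> 0" "\<bar>z\<bar> < int n"
  using that zdvd_imp_le[of "int n" "\<bar>z\<bar>"] by auto

lemma separatedD:
  assumes "separated n k D t" "i < k" "j < k" "i \<noteq> j" "\<bar>e\<bar> \<le> D"
  shows "\<not> int n dvd t i - t j - e"
  using assms by (auto simp: separated_def)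

lemma separated_mono: "separated n k D t \<Longrightarrow> D' \<le> D \<Longrightarrow> separated n k D' t"
  by (auto simp: separated_def)

lemma separated_shift:
  assumes "separated n k (D + 1) t" "\<bar>d\<bar> \<le> 1"
  shows "separated n k D (t(j := t j + d))"
  unfolding separated_def
proof (intro allI impI)
  fix a b e assume *: "a < k" "b < k" "a \<noteq> b" "\<bar>e\<bar> \<le> D"
  define u where "u = (if a = j then d else 0) - (if b = j then d else 0)"
  have "\<bar>u\<bar> \<le> 1" using * assms(2) by (auto simp: u_def)
  then have "\<not> int n dvd t a - t b - (e - u)"
    using * by (intro separatedD[OF assms(1)]) auto
  moreover have eq: "(t(j := t j + d)) a - (t(j := t j + d)) b - e = t a - t b - (e - u)"
    by (auto simp: u_def)
  ultimately show "\<not> int n dvd (t(j := t j + d)) a - (t(j := t j + d)) b - e"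
    unfolding eq by blast
qed

lemma separated_cong_mod:
  assumes "\<And>i. i < k \<Longrightarrow> int n dvd t i - t' i"
  shows "separated n k D t \<longleftrightarrow> separated n k D t'"
proof -
  have "int n dvd t i - t j - e \<longleftrightarrow> int n dvd t' i - t' j - e" if "i < k" "j < k" for i j e
  proof -
    have "int n dvd (t i - t' i) - (t j - t' j)" 
      by (rule dvd_diff) (use assms that in auto)
    moreover have "t i - t j - e = (t i - t' i) - (t j - t' j) + (t' i - t' j - e)" by simp
    ultimately show ?thesis by (metis dvd_add_right_iff)
  qed
  then show ?thesis by (simp add: separated_def)
qed

lemma image_interval_cong_mod:
  assumes "C \<in> cycles n" "int n dvd a - b"
  shows "C ` {a + 1..a + m} = C ` {b + 1..b + m}"
proof -
  have "C ` {a + 1..a + m} \<subseteq> C ` {b + 1..b + m}" if "int n dvd a - b" for a b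
  proof
    fix v assume "v \<in> C ` {a + 1..a + m}"
    then obtain z where z: "v = C z" "z \<in> {a + 1..a + m}" by blast
    then have "v = C (z - (a - b))" 
      using cycles_eq_iff[OF assms(1), of z "z - (a - b)"] that by simp
    then show "v \<in> C ` {b + 1..b + m}" using z(2) by (intro image_eqI[of _ _ "z - (a - b)"]) auto
  qed
  from this[of a b] this[of b a] assms(2) show ?thesis by (metis dvd_diff_commute subset_antisym)
qed

lemma blocks_cong_mod:
  assumes "C \<in> cycles n" "\<And>i. i < length x \<Longrightarrow> int n dvd t i - t' i"
  shows "blocks x C t = blocks x C t'"
  unfolding blocks_def using image_interval_cong_mod[OF assms(1)] assms(2) by (intro SUP_cong) auto

text \<open>
  If the starting points are far apart, then rotating a window close to the \<open>j\<close>-th interval does not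
  touch the other intervals.
\<close>
lemma other_blocks_comp_rot:
  assumes "separated n (length x) D t" "j < length x" "0 \<le> a" "a + l \<le> D"
    "int (sum_list x) \<le> D" "0 < n"
  shows "other_blocks x (C \<circ> rot n (t j + a) l) t j = other_blocks x C t j"
proof -
  have "rot n (t j + a) l z = z"
    if i: "i < length x" "i \<noteq> j" and z: "z \<in> {t i + 1..t i + int (x ! i)}" for i z
  proof (rule rot_outside[OF assms(6)])
    fix e assume e: "0 \<le> e" "e \<le> l"
    have "int (x ! i) \<le> D" using elem_le_sum_list[OF i(1)] assms(5) by linarith
    then have "\<not> int n dvd t i - t j - (t i + a + e - z)"
      using i z e assms by (intro separatedD[OF assms(1)]) auto
    then show "\<not> int n dvd z - (t j + a) - e" by (simp add: algebra_simps)
  qed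
  then have "(C \<circ> rot n (t j + a) l) ` {t i + 1..t i + int (x ! i)} = C ` {t i + 1..t i + int (x ! i)}"
    if "i < length x" "i \<noteq> j" for i
    using that by (intro image_cong) auto
  then show ?thesis by (auto simp: other_blocks_def)
qed

lemma not_in_other_blocks:
  assumes "C \<in> cycles n" "separated n (length x) D t" "j < length x" "0 \<le> a" "a \<le> D"
    "int (sum_list x) \<le> D"
  shows "C (t j + a) \<notin> other_blocks x C t j"
proof
  assume "C (t j + a) \<in> other_blocks x C t j"
  then obtain i where i: "i < length x" "i \<noteq> j"
    and "C (t j + a) \<in> C ` {t i + 1..t i + int (x ! i)}"
    unfolding other_blocks_def by blast
  then obtain z where z: "z \<in> {t i + 1..t i + int (x ! i)}" and "C z = C (t j + a)"
    by auto
  then have "int n dvd z - (t j + a)" using cycles_eq_iff[OF assms(1)] by metis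
  moreover have "\<not> int n dvd t i - t j - (t i + a - z)"
    using i z elem_le_sum_list[OF i(1)] assms by (intro separatedD[OF assms(2)]) auto
  ultimately show False by (simp add: algebra_simps)
qed

lemma comp_rot_1:
  assumes "C \<in> cycles n" "1 < n"
  shows "C \<circ> rot n q 1 = transpose (C q) (C (q + 1)) \<circ> C"
proof
  fix z
  have D: "C \<circ> rot n q 1 \<in> cycles n" using comp_rot_in_cycles[OF assms(1)] assms by simp
  have D0: "C (rot n q 1 q) = C (q + 1)" and D1: "C (rot n q 1 (q + 1)) = C q"
    using rot_low[of q q 1] rot_top[of 1 n q] assms(2) by auto
  consider "C z = C q" | "C z = C (q + 1)" | "C z \<noteq> C q" "C z \<noteq> C (q + 1)" by blast
  then show "(C \<circ> rot n q 1) z = (transpose (C q) (C (q + 1)) \<circ> C) z"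
  proof cases
    case 1
    then have "int n dvd z - q" using cycles_eq_iff[OF assms(1)] by simp
    then have "(C \<circ> rot n q 1) z = (C \<circ> rot n q 1) q" by (simp only: cycles_eq_iff[OF D])
    then show ?thesis using 1 D0 by simp
  next
    case 2
    then have "int n dvd z - (q + 1)" using cycles_eq_iff[OF assms(1)] by simp
    then have "(C \<circ> rot n q 1) z = (C \<circ> rot n q 1) (q + 1)" by (simp only: cycles_eq_iff[OF D])
    then show ?thesis using 2 D1 by simp
  next
    case 3
    have "rot n q 1 z = z"
    proof (rule rot_outside)
      fix e :: int assume "0 \<le> e" "e \<le> 1"
      then have "e = 0 \<or> e = 1" by linarith
      then show "\<not> int n dvd z - q - e" 
        using 3 cycles_eq_iff[OF assms(1), of z q] cycles_eq_iff[OF assms(1), of z "q + 1"]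
        by (auto simp: diff_diff_eq)
    qed (use assms in simp)
    then show ?thesis using 3 by simp
  qed
qed

text \<open>
  The heart of the argument. All members of \<open>F\<close> that \<open>C\<close> exhibits are equal to one set \<open>B\<close>, and an
  interval of \<open>B\<close> has \<open>l \<ge> 2\<close> vertices \<open>v\<^sub>1, \<dots>, v\<^sub>l\<close> and is preceded by the vertex \<open>u = C q\<close>. Swapping
  \<open>u\<close> and \<open>v\<^sub>1\<close> gives a cycle that exhibits a member \<open>B'\<close> of \<open>F\<close>. If \<open>B'\<close> contained both or neither
  of \<open>u, v\<^sub>1\<close>, then \<open>C\<close> would exhibit it, hence \<open>B' = B\<close>, which is absurd since \<open>B\<close> contains \<open>v\<^sub>1\<close> but
  not \<open>u\<close>. So one interval of \<open>B'\<close> either ends in \<open>v\<^sub>1\<close> or starts with \<open>u\<close> after the swap. In the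
  first case the local order \<open>v\<^sub>1, \<dots>, v\<^sub>l, u\<close> makes \<open>B\<close> and \<open>B'\<close> visible at the same time; the same
  order works in the second case if the interval of \<open>B'\<close> has length at least \<open>l\<close>; otherwise the
  order \<open>u, v\<^sub>2, \<dots>, v\<^sub>l, v\<^sub>1\<close> does. This needs the other intervals of \<open>B\<close> and \<open>B'\<close> to stay
  clear of the window; without that, the tuple of \<open>B'\<close> is at least known to touch position \<open>q\<close>,
  which is the first conclusion.
\<close>
lemma second_blocks:
  fixes x :: "nat list" and n :: nat and t t' :: "nat \<Rightarrow> int"
  defines "R \<equiv> int (sum_list x)"
  assumes C: "C \<in> cycles n" and n: "2 * R + 2 < int n"
    and j: "j < length x" and l: "l = int (x ! j)" "2 \<le> l" and q: "q = t j"
    and sep: "separated n (length x) (2 * R + 1) t"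
    and uniq: "\<And>u. blocks x C u \<in> F \<Longrightarrow> blocks x C u = blocks x C t"
    and B'F: "blocks x (C \<circ> rot n q 1) t' \<in> F"
  shows "\<exists>i<length x. \<exists>b\<le>sum_list x. int n dvd q - (t' i + int b)"
    and "separated n (length x) (2 * R + 1) t' \<Longrightarrow>
      blocks x (C \<circ> rot n q l) (t(j := q - 1)) = blocks x C t \<and>
        (\<exists>t''. separated n (length x) (2 * R) t'' \<and>
          blocks x (C \<circ> rot n q l) t'' \<in> F - {blocks x C t}) \<or>
      blocks x (C \<circ> rot n (q + 1) (l - 1)) t = blocks x C t \<and>
        (\<exists>t''. separated n (length x) (2 * R) t'' \<and>
          blocks x (C \<circ> rot n (q + 1) (l - 1)) t'' \<in> F - {blocks x C t})"
proof -
  define C' where "C' = C \<circ> rot n q 1"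
  define C1 where "C1 = C \<circ> rot n q l"
  define C2 where "C2 = C \<circ> rot n (q + 1) (l - 1)"
  define B where "B = blocks x C t"
  define B' where "B' = blocks x C' t'"
  have lR: "l \<le> R" using elem_le_sum_list[OF j] by (simp add: l R_def)
  have n0: "0 < n" "1 < n" using n lR l by auto
  have ln: "0 \<le> l" "l < int n" "2 * l < int n" using lR l(2) n by auto
  have C': "C' \<in> cycles n" unfolding C'_def using comp_rot_in_cycles[OF C] n0 by simp
  note iff = cycles_eq_iff[OF C] and iff' = cycles_eq_iff[OF C']
  have C'q: "C' q = C (q + 1)" and C'q1: "C' (q + 1) = C q"
    using rot_low[of q q 1] rot_top[of 1 n q] n0 by (auto simp: C'_def)
  have C'z: "C' z = C z" if "\<not> int n dvd z - q" "\<not> int n dvd z - (q + 1)" for z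
  proof -
    have "rot n q 1 z = z"
    proof (rule rot_outside)
      fix e :: int assume "0 \<le> e" "e \<le> 1"
      then have "e = 0 \<or> e = 1" by linarith
      then show "\<not> int n dvd z - q - e" using that by (auto simp: diff_diff_eq)
    qed (use n0 in simp)
    then show ?thesis by (simp add: C'_def)
  qed
  have B_split: "B = C ` {q + 1..q + l} \<union> other_blocks x C t j"
    using blocks_eq_Un[OF j] by (simp add: B_def q l)
  have CqB: "C q \<notin> B"
  proof -
    have "C q \<notin> other_blocks x C t j"
      using not_in_other_blocks[OF C sep j, of 0] lR l(2) by (simp add: q R_def)
    moreover have "C q \<noteq> C z" if "z \<in> {q + 1..q + l}" for z
      unfolding iff using that ln by (intro not_dvd_small) auto
    then have "C q \<notin> C ` {q + 1..q + l}" by blast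
    ultimately show ?thesis by (simp add: B_split)
  qed
  have CB: "C (q + 1) \<in> B" "C (q + 2) \<in> B"
  proof -
    have "q + 1 \<in> {q + 1..q + l}" "q + 2 \<in> {q + 1..q + l}" using l(2) by simp_all
    then show "C (q + 1) \<in> B" "C (q + 2) \<in> B" unfolding B_split by blast+
  qed
  have xor: "C q \<in> B' \<longleftrightarrow> C (q + 1) \<notin> B'"
  proof (rule ccontr)
    assume "\<not> ?thesis"
    then have eq: "C q \<in> B' \<longleftrightarrow> C (q + 1) \<in> B'" by blast
    have "B' = transpose (C q) (C (q + 1)) ` blocks x C t'"
      unfolding B'_def C'_def comp_rot_1[OF C n0(2)] blocks_def image_UN image_comp ..
    then have "blocks x C t' = transpose (C q) (C (q + 1)) ` B'"
      by (simp add: image_comp)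
    also have "\<dots> = B'" by (rule transpose_image_eq) (use eq in simp)
    finally have "blocks x C t' = B'" .
    then have "B' = B" using uniq[of t'] B'F by (simp add: B'_def C'_def B_def)
    then show False using eq CqB CB by simp
  qed
  have alternatives:
    "(\<exists>i<length x. int n dvd q - (t' i + int (x ! i)) \<and> 1 \<le> x ! i \<and> C q \<notin> B') \<or>
     (\<exists>i<length x. int n dvd q - t' i \<and> 1 \<le> x ! i \<and> C q \<in> B')"
  proof (cases "C q \<in> B'")
    case True
    then have "C' (q + 1) \<in> B'" by (simp only: C'q1)
    then obtain i where i: "i < length x" and "C' (q + 1) \<in> C' ` {t' i + 1..t' i + int (x ! i)}"
      unfolding B'_def blocks_def by blast
    then obtain z where z: "z \<in> {t' i + 1..t' i + int (x ! i)}" and "C' (q + 1) = C' z"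
      by blast
    then have eq: "int n dvd (q + 1) - z" by (simp only: iff')
    have "z = t' i + 1"
    proof (rule ccontr)
      assume "z \<noteq> t' i + 1"
      then have "z - 1 \<in> {t' i + 1..t' i + int (x ! i)}" using z by auto
      moreover have "C' q = C' (z - 1)" using eq unfolding iff' by (simp add: algebra_simps)
      ultimately have "C' q \<in> B'" using i unfolding B'_def blocks_def by blast
      then show False using True xor by (simp add: C'q)
    qed
    then have "int n dvd q - t' i" "1 \<le> x ! i" using eq z by auto
    then show ?thesis using i True by blast
  next
    case False
    then have "C' q \<in> B'" using xor unfolding C'q by blast
    then obtain i where i: "i < length x" and "C' q \<in> C' ` {t' i + 1..t' i + int (x ! i)}"
      unfolding B'_def blocks_def by blast
    then obtain z where z: "z \<in> {t' i + 1..t' i + int (x ! i)}" and "C' q = C' z"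
      by blast
    then have eq: "int n dvd q - z" by (simp only: iff')
    have "z = t' i + int (x ! i)"
    proof (rule ccontr)
      assume "z \<noteq> t' i + int (x ! i)"
      then have "z + 1 \<in> {t' i + 1..t' i + int (x ! i)}" using z by auto
      moreover have "C' (q + 1) = C' (z + 1)" using eq unfolding iff' by (simp add: algebra_simps)
      ultimately have "C' (q + 1) \<in> B'" using i unfolding B'_def blocks_def by blast
      then show False using False by (simp add: C'q1)
    qed
    then have "int n dvd q - (t' i + int (x ! i))" "1 \<le> x ! i" using eq z by auto
    then show ?thesis using i False by blast
  qed
  then show "\<exists>i<length x. \<exists>b\<le>sum_list x. int n dvd q - (t' i + int b)"
  proof (elim disjE exE conjE)
    fix i assume i: "i < length x" "int n dvd q - (t' i + int (x ! i))"
    then show ?thesis using elem_le_sum_list[OF i(1)] by blast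
  next
    fix i assume i: "i < length x" "int n dvd q - t' i"
    then have "int n dvd q - (t' i + int 0)" by simp
    then show ?thesis using i(1) by blast
  qed

  assume sep': "separated n (length x) (2 * R + 1) t'"
  have B1: "blocks x C1 (t(j := q - 1)) = B"
  proof -
    have "C1 ` {q..q - 1 + l} = C ` {q + 1..q + l}"
    proof -
      have "C1 ` {q..q - 1 + l} = C ` ((\<lambda>z. z + 1) ` {q..q - 1 + l})"
        unfolding image_image C1_def using rot_low[of q _ l n] ln by (intro image_cong) auto
      then show ?thesis by (simp add: add.commute)
    qed
    moreover have "other_blocks x C1 t j = other_blocks x C t j"
      using other_blocks_comp_rot[OF sep j, of 0 l C] lR l(2) n0 by (simp add: C1_def q R_def)
    ultimately show ?thesis
      using blocks_eq_Un[OF j, of C1 "t(j := q - 1)"] by (simp add: B_split l)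
  qed
  have B2: "blocks x C2 t = B"
  proof -
    have "C2 ` {q + 1..q + l} = C ` {q + 1..q + l}"
    proof -
      have "{q + 1..q + l} = insert (q + l) {q + 1..q + l - 1}" using l by auto
      then have "C2 ` {q + 1..q + l} = insert (C2 (q + l)) (C2 ` {q + 1..q + l - 1})" by (metis image_insert)
      also have "C2 (q + l) = C (q + 1)" using rot_top[of "l - 1" n "q + 1"] l ln by (simp add: C2_def)
      also have "C2 ` {q + 1..q + l - 1} = C ` ((\<lambda>z. z + 1) ` {q + 1..q + l - 1})"
        unfolding image_image C2_def using rot_low[of "q + 1" _ "l - 1" n] ln by (intro image_cong) auto
      also have "(\<lambda>z. z + 1) ` {q + 1..q + l - 1} = {q + 2..q + l}" by (simp add: add.commute)
      also have "insert (C (q + 1)) (C ` {q + 2..q + l}) = C ` (insert (q + 1) {q + 2..q + l})" by simp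
      also have "insert (q + 1) {q + 2..q + l} = {q + 1..q + l}" using l by auto
      finally show ?thesis .
    qed
    moreover have "other_blocks x C2 t j = other_blocks x C t j"
      using other_blocks_comp_rot[OF sep j, of 1 "l - 1" C] lR l(2) n0 by (simp add: C2_def q R_def)
    ultimately show ?thesis
      using blocks_eq_Un[OF j, of C2 t] by (simp add: B_split l q)
  qed
  have B'F': "B' \<in> F" using B'F by (simp add: B'_def C'_def)
  have "(\<exists>t''. separated n (length x) (2 * R) t'' \<and> blocks x C1 t'' = B' \<and> B' \<noteq> B) \<or>
    (\<exists>t''. separated n (length x) (2 * R) t'' \<and> blocks x C2 t'' = B' \<and> B' \<noteq> B)"
    using alternatives
  proof (elim disjE exE conjE)
    \<comment> \<open>An interval of length \<open>m\<close> of \<open>B'\<close> ends in \<open>C (q + 1)\<close>, which the swap puts at position \<open>q\<close>.\<close>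
    fix i assume i: "i < length x" "int n dvd q - (t' i + int (x ! i))" "1 \<le> x ! i" "C q \<notin> B'"
    define m where "m = int (x ! i)"
    have m: "1 \<le> m" "m \<le> R" using i elem_le_sum_list[OF i(1)] by (auto simp: m_def R_def)
    define t1 where "t1 = t'(i := q - m)"
    have t1: "int n dvd t' a - t1 a" for a
      using i(2) by (simp add: t1_def m_def diff_diff_eq2 dvd_diff_commute)
    have sep1: "separated n (length x) (2 * R + 1) t1"
      using separated_cong_mod[of "length x" n t' t1] t1 sep' by simp
    have B't1: "B' = blocks x C' t1" using blocks_cong_mod[OF C'] t1 unfolding B'_def by blast
    have B'_split: "B' = C' ` {q - m + 1..q} \<union> other_blocks x C' t1 i"
      unfolding B't1 using blocks_eq_Un[OF i(1), of C' t1] by (simp add: t1_def m_def)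
    have o': "other_blocks x C' t1 i = other_blocks x C t1 i"
      using other_blocks_comp_rot[OF sep1 i(1), of m 1 C] m n0 by (simp add: C'_def t1_def R_def)
    have o1: "other_blocks x C1 t1 i = other_blocks x C t1 i"
      using other_blocks_comp_rot[OF sep1 i(1), of m l C] m lR n0 by (simp add: C1_def t1_def R_def)
    have "C1 z = C' z" if z: "z \<in> {q - m + 1..q}" for z
    proof (cases "z = q")
      case True
      then show ?thesis using rot_low[of q q l n] ln l by (simp add: C1_def C'q)
    next
      case False
      have "rot n q l z = z"
        using n0 z False m lR n by (intro rot_outside not_dvd_small) auto
      moreover have "C' z = C z" using z False m lR n by (intro C'z not_dvd_small) auto
      ultimately show ?thesis by (simp add: C1_def)
    qed
    then have "C1 ` {q - m + 1..q} = C' ` {q - m + 1..q}" by (intro image_cong) auto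
    then have "blocks x C1 t1 = B'"
      using blocks_eq_Un[OF i(1), of C1 t1] o' o1 by (simp add: B'_split t1_def m_def)
    moreover have "C (q + 2) \<notin> B'"
    proof -
      have C2: "C (q + 2) = C' (q + 2)"
        using n lR l by (intro C'z[symmetric] not_dvd_small) auto
      have "C' (q + 2) \<noteq> C' z" if "z \<in> {q - m + 1..q}" for z
        unfolding iff' using that m lR l n by (intro not_dvd_small) auto
      moreover have "C' (q + 2) \<notin> other_blocks x C' t1 i"
        using not_in_other_blocks[OF C' sep1 i(1), of "m + 2"] m lR l by (simp add: t1_def R_def)
      ultimately show ?thesis unfolding B'_split C2 by blast
    qed
    then have "B' \<noteq> B" using CB by blast
    ultimately show ?thesis using separated_mono[OF sep1] by fastforce
  next
    \<comment> \<open>An interval of length \<open>m\<close> of \<open>B'\<close> starts with \<open>C q\<close>, which the swap puts at position \<open>q + 1\<close>.\<close>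
    fix i assume i: "i < length x" "int n dvd q - t' i" "1 \<le> x ! i" "C q \<in> B'"
    define m where "m = int (x ! i)"
    have m: "1 \<le> m" "m \<le> R" using i elem_le_sum_list[OF i(1)] by (auto simp: m_def R_def)
    define t1 where "t1 = t'(i := q)"
    have t1: "int n dvd t' a - t1 a" for a
      using i(2) by (simp add: t1_def dvd_diff_commute)
    have sep1: "separated n (length x) (2 * R + 1) t1"
      using separated_cong_mod[of "length x" n t' t1] t1 sep' by simp
    have B't1: "B' = blocks x C' t1" using blocks_cong_mod[OF C'] t1 unfolding B'_def by blast
    have B'_split: "B' = C' ` {q + 1..q + m} \<union> other_blocks x C' t1 i"
      unfolding B't1 using blocks_eq_Un[OF i(1), of C' t1] by (simp add: t1_def m_def)
    have o': "other_blocks x C' t1 i = other_blocks x C t1 i"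
      using other_blocks_comp_rot[OF sep1 i(1), of 0 1 C] m n0 by (simp add: C'_def t1_def R_def)
    have ne: "B' \<noteq> B" using CqB i(4) by blast
    have I': "C' ` {q + 1..q + m} = insert (C q) (C ` {q + 2..q + m})"
    proof -
      have "C' ` {q + 2..q + m} = C ` {q + 2..q + m}"
        using m n by (intro image_cong refl C'z not_dvd_small) auto
      moreover have "{q + 1..q + m} = insert (q + 1) {q + 2..q + m}" using m by auto
      ultimately show ?thesis by (simp add: C'q1)
    qed
    show ?thesis
    proof (cases "l \<le> m")
      case True
      have "C1 ` {q + 1..q + m} = insert (C q) (C ` {q + 2..q + m})"
      proof -
        have "{q + 1..q + m} = insert (q + l) ({q + 1..q + l - 1} \<union> {q + l + 1..q + m})"
          using True l by auto
        then have "C1 ` {q + 1..q + m} = 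
            insert (C1 (q + l)) (C1 ` {q + 1..q + l - 1} \<union> C1 ` {q + l + 1..q + m})"
          by (metis image_insert image_Un)
        also have "C1 (q + l) = C q" using rot_top[of l n q] ln by (simp add: C1_def)
        also have "C1 ` {q + 1..q + l - 1} = C ` ((\<lambda>z. z + 1) ` {q + 1..q + l - 1})"
          unfolding image_image C1_def using rot_low[of q _ l n] ln by (intro image_cong) auto
        also have "(\<lambda>z. z + 1) ` {q + 1..q + l - 1} = {q + 2..q + l}" by (simp add: add.commute)
        also have "C1 ` {q + l + 1..q + m} = C ` {q + l + 1..q + m}"
        proof (intro image_cong refl)
          fix z assume "z \<in> {q + l + 1..q + m}"
          then have "rot n q l z = z" using n0 m n by (intro rot_outside not_dvd_small) auto
          then show "C1 z = C z" by (simp add: C1_def)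
        qed
        also have "C ` {q + 2..q + l} \<union> C ` {q + l + 1..q + m} = C ` ({q + 2..q + l} \<union> {q + l + 1..q + m})"
          by (simp only: image_Un)
        also have "{q + 2..q + l} \<union> {q + l + 1..q + m} = {q + 2..q + m}" using True l by auto
        finally show ?thesis .
      qed
      moreover have "other_blocks x C1 t1 i = other_blocks x C t1 i"
        using other_blocks_comp_rot[OF sep1 i(1), of 0 l C] lR l(2) n0 by (simp add: C1_def t1_def R_def)
      ultimately have "blocks x C1 t1 = B'"
        using blocks_eq_Un[OF i(1), of C1 t1] o' I' by (simp add: B'_split t1_def m_def)
      then show ?thesis using ne separated_mono[OF sep1] by fastforce
    next
      case False
      have "C2 ` {q..q - 1 + m} = insert (C q) (C ` {q + 2..q + m})"
      proof -
        have "{q..q - 1 + m} = insert q {q + 1..q - 1 + m}" using m by auto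
        then have "C2 ` {q..q - 1 + m} = insert (C2 q) (C2 ` {q + 1..q - 1 + m})"
          by (metis image_insert)
        also have "C2 q = C q"
        proof -
          have "rot n (q + 1) (l - 1) q = q" using n0 ln by (intro rot_outside not_dvd_small) auto
          then show ?thesis by (simp add: C2_def)
        qed
        also have "C2 ` {q + 1..q - 1 + m} = C ` ((\<lambda>z. z + 1) ` {q + 1..q - 1 + m})"
          unfolding image_image C2_def using rot_low[of "q + 1" _ "l - 1" n] ln False
          by (intro image_cong) auto
        also have "(\<lambda>z. z + 1) ` {q + 1..q - 1 + m} = {q + 2..q + m}" by (simp add: add.commute)
        finally show ?thesis .
      qed
      moreover have "other_blocks x C2 t1 i = other_blocks x C t1 i"
        using other_blocks_comp_rot[OF sep1 i(1), of 1 "l - 1" C] lR l(2) n0 by (simp add: C2_def t1_def R_def)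
      ultimately have "blocks x C2 (t1(i := t1 i + (- 1))) = B'"
        using blocks_eq_Un[OF i(1), of C2 "t1(i := t1 i + (- 1))"] o' I' 
        by (simp add: B'_split t1_def m_def)
      then show ?thesis using ne separated_shift[OF sep1, of "- 1" i] by fastforce
    qed
  qed
  then show "blocks x (C \<circ> rot n q l) (t(j := q - 1)) = blocks x C t \<and>
        (\<exists>t''. separated n (length x) (2 * R) t'' \<and>
          blocks x (C \<circ> rot n q l) t'' \<in> F - {blocks x C t}) \<or>
      blocks x (C \<circ> rot n (q + 1) (l - 1)) t = blocks x C t \<and>
        (\<exists>t''. separated n (length x) (2 * R) t'' \<and>
          blocks x (C \<circ> rot n (q + 1) (l - 1)) t'' \<in> F - {blocks x C t})"
    using B1 B2 B'F' unfolding B_def[symmetric] C1_def[symmetric] C2_def[symmetric] by auto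
qed

section \<open>Counting cycles and tuples of starting points\<close>
lemma nsets_bij_exists:
  fixes V :: "nat set"
  assumes "finite V" "A \<in> nsets V r" "A' \<in> nsets V r"
  obtains f where "bij_betw f V V" "f ` A = A'"
proof -
  have A: "A \<subseteq> V" "finite A" "card A = r" and A': "A' \<subseteq> V" "finite A'" "card A' = r"
    using assms by (auto simp: nsets_def)
  obtain g where g: "bij_betw g A A'" using A A' by (metis finite_same_card_bij)
  have "card (V - A) = card (V - A')" using A A' by (simp add: card_Diff_subset)
  then obtain h where h: "bij_betw h (V - A) (V - A')"
    using assms(1) by (metis finite_Diff finite_same_card_bij)
  define f where "f = (\<lambda>v. if v \<in> A then g v else h v)"
  have fA: "bij_betw f A A'" using g by (rule bij_betw_cong[THEN iffD1, rotated]) (simp add: f_def)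
  have "bij_betw f (V - A) (V - A')"
    using h by (rule bij_betw_cong[THEN iffD1, rotated]) (simp add: f_def)
  from bij_betw_combine[OF fA this] have "bij_betw f V V"
    using A A' by (simp add: Un_absorb1)
  with fA that show thesis by (auto simp: bij_betw_def)
qed

lemma cycles_comp_bij:
  assumes "C \<in> cycles n" "bij_betw f {1..n} {1..n}"
  shows "f \<circ> C \<in> cycles n"
proof -
  have rC: "range C = {1..n}" using assms by (simp add: cycles_def)
  then have "f (C y) = f (C z) \<longleftrightarrow> C y = C z" for y z
    using assms(2) by (metis bij_betw_def inj_on_eq_iff rangeI)
  moreover have "range (f \<circ> C) = {1..n}" using rC assms(2) by (metis bij_betw_def image_comp)
  ultimately show ?thesis using assms by (simp add: cycles_def)
qed

text \<open>
  The set of vertices at the positions \<open>P\<close> of a uniformly random cycle is a uniformly random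
  \<open>r\<close>-set if \<open>P\<close> consists of \<open>r\<close> residue classes, because relabelling the vertices permutes the cycles.
  If the number of residue classes of \<open>P\<close> is not \<open>r\<close>, the left-hand side vanishes.
\<close>
lemma card_cycles_image_le:
  assumes "F \<subseteq> nsets {1..n} r"
  shows "card {C \<in> cycles n. C ` P \<in> F} * (n choose r) \<le> card F * card (cycles n)"
proof -
  define N where "N A = {C \<in> cycles n. C ` P = A}" for A
  have fin: "finite (N A)" for A using finite_cycles by (simp add: N_def)
  have le: "card (N A) \<le> card (N A')" if A: "A \<in> nsets {1..n} r" "A' \<in> nsets {1..n} r" for A A'
  proof -
    obtain f where f: "bij_betw f {1..n} {1..n}" "f ` A = A'"
      using nsets_bij_exists[OF _ A] by auto
    have "inj_on (\<lambda>C. f \<circ> C) (N A)"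
    proof (rule inj_onI, rule ext)
      fix C D z assume CD: "C \<in> N A" "D \<in> N A" "f \<circ> C = f \<circ> D"
      then have "f (C z) = f (D z)" by (metis comp_apply)
      moreover have "C z \<in> {1..n}" "D z \<in> {1..n}" using CD by (auto simp: N_def cycles_def)
      ultimately show "C z = D z" using f(1) by (metis bij_betw_def inj_on_eq_iff)
    qed
    moreover have "(\<lambda>C. f \<circ> C) ` N A \<subseteq> N A'"
      using f cycles_comp_bij[OF _ f(1)] by (auto simp: N_def image_comp[symmetric])
    ultimately show ?thesis using fin by (metis card_inj_on_le)
  qed
  have "card (N A) * (n choose r) \<le> card (cycles n)" if "A \<in> F" for A
  proof -
    have "card (N A) * (n choose r) = (\<Sum>A'\<in>nsets {1..n} r. card (N A))" by (simp add: card_nsets)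
    also have "\<dots> \<le> (\<Sum>A'\<in>nsets {1..n} r. card (N A'))" using that assms le by (intro sum_mono) auto
    also have "\<dots> = card (\<Union>A'\<in>nsets {1..n} r. N A')"
      using fin by (intro card_UN_disjoint[symmetric]) (auto simp: N_def finite_imp_finite_nsets)
    also have "\<dots> \<le> card (cycles n)" using finite_cycles by (intro card_mono) (auto simp: N_def)
    finally show ?thesis .
  qed
  then have "(\<Sum>A\<in>F. card (N A) * (n choose r)) \<le> card F * card (cycles n)"
    by (metis (no_types, lifting) of_nat_id sum_bounded_above)
  moreover have "card {C \<in> cycles n. C ` P \<in> F} = (\<Sum>A\<in>F. card (N A))"
  proof -
    have "finite F" using assms finite_subset finite_imp_finite_nsets by blast
    moreover have "{C \<in> cycles n. C ` P \<in> F} = (\<Union>A\<in>F. N A)" by (auto simp: N_def)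
    ultimately show ?thesis using fin by (subst card_UN_disjoint[symmetric]) (auto simp: N_def)
  qed
  ultimately show ?thesis by (simp add: sum_distrib_right)
qed

text \<open>Tuples of \<open>k\<close> starting points, with residues normalised to \<open>{0..<n}\<close>.\<close>
definition start_tuples :: "nat \<Rightarrow> nat \<Rightarrow> (nat \<Rightarrow> int) set" where
  "start_tuples n k = {..<k} \<rightarrow>\<^sub>E {0..<int n}"

lemma finite_start_tuples: "finite (start_tuples n k)"
  by (simp add: start_tuples_def finite_PiE)

lemma card_start_tuples: "card (start_tuples n k) = n ^ k"
  by (simp add: start_tuples_def card_PiE)

lemma start_tuples_reduce:
  assumes "0 < n"
  obtains u where "u \<in> start_tuples n k" "\<And>i. i < k \<Longrightarrow> int n dvd t i - u i"
proof
  show "(\<lambda>i\<in>{..<k}. t i mod int n) \<in> start_tuples n k" using assms by (auto simp: start_tuples_def)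
qed (simp add: dvd_minus_mod)

lemma start_tuples_mod: "t \<in> start_tuples n k \<Longrightarrow> i < k \<Longrightarrow> t i mod int n = t i"
  by (auto simp: start_tuples_def PiE_iff)

text \<open>
  If \<open>t i\<close> and \<open>t j\<close> differ by a given small number modulo \<open>n\<close>, then \<open>t i\<close> is determined by the
  other entries.
\<close>
lemma card_not_separated_le:
  "card {t \<in> start_tuples n k. \<not> separated n k (int D) t} \<le> k * k * (2 * D + 1) * n ^ (k - 1)"
proof -
  define Z where "Z = (\<lambda>(i, j, e). {t \<in> start_tuples n k. i \<noteq> j \<and> int n dvd t i - t j - e})"
  let ?I = "{..<k} \<times> {..<k} \<times> {- int D..int D}"
  have "{t \<in> start_tuples n k. \<not> separated n k (int D) t} \<subseteq> (\<Union>p\<in>?I. Z p)"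
  proof
    fix t assume "t \<in> {t \<in> start_tuples n k. \<not> separated n k (int D) t}"
    then obtain i j e where "t \<in> start_tuples n k" "i < k" "j < k" "i \<noteq> j" "\<bar>e\<bar> \<le> int D"
      "int n dvd t i - t j - e" by (auto simp: separated_def)
    then show "t \<in> (\<Union>p\<in>?I. Z p)" by (intro UN_I[of "(i, j, e)"]) (auto simp: Z_def)
  qed
  then have "card {t \<in> start_tuples n k. \<not> separated n k (int D) t} \<le> card (\<Union>p\<in>?I. Z p)"
    by (intro card_mono) (auto simp: Z_def finite_start_tuples)
  also have "\<dots> \<le> (\<Sum>p\<in>?I. card (Z p))" by (intro card_UN_le) auto
  also have "\<dots> \<le> of_nat (card ?I) * n ^ (k - 1)"
  proof (rule sum_bounded_above)
    fix p assume "p \<in> ?I"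
    then obtain i j e where p: "p = (i, j, e)" "i < k" "j < k" by auto
    show "card (Z p) \<le> n ^ (k - 1)"
    proof (cases "i = j")
      case False
      let ?E = "({..<k} - {i}) \<rightarrow>\<^sub>E {0..<int n}"
      have "inj_on (\<lambda>t. restrict t ({..<k} - {i})) (Z p)"
      proof (rule inj_onI)
        fix t u assume t: "t \<in> Z p" and u: "u \<in> Z p"
          and eq: "restrict t ({..<k} - {i}) = restrict u ({..<k} - {i})"
        have tu: "t \<in> start_tuples n k" "u \<in> start_tuples n k" using t u by (auto simp: Z_def p)
        have off: "t a = u a" if "a < k" "a \<noteq> i" for a
          using fun_cong[OF eq, of a] that by simp
        have "int n dvd (t i - t j - e) - (u i - u j - e)"
          using t u by (intro dvd_diff[of _ "t i - t j - e"]) (auto simp: Z_def p)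
        then have "int n dvd t i - u i" using off[of j] p False by simp
        then have "t i = u i" using start_tuples_mod[OF tu(1) p(2)] start_tuples_mod[OF tu(2) p(2)]
          by (simp add: mod_eq_dvd_iff[symmetric])
        then show "t = u" using off tu unfolding start_tuples_def 
          by (intro PiE_ext[of t "{..<k}" "\<lambda>_. {0..<int n}" u]) auto
      qed
      moreover have "(\<lambda>t. restrict t ({..<k} - {i})) ` Z p \<subseteq> ?E"
        by (auto simp: Z_def p start_tuples_def PiE_iff split: if_splits)
      ultimately have "card (Z p) \<le> card ?E" by (intro card_inj_on_le) (auto intro: finite_PiE)
      also have "card ?E = n ^ (k - 1)" using p by (simp add: card_PiE)
      finally show ?thesis .
    qed (simp add: Z_def p)
  qed
  also have "card ?I = k * k * (2 * D + 1)" by (simp add: card_cartesian_product nat_add_distrib nat_mult_distrib algebra_simps)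
  finally show ?thesis by simp
qed

text \<open>
  The permutations of the indices that preserve the vector \<open>x\<close>. Permuting a tuple of starting points
  by such a permutation does not change the union of the intervals.
\<close>
definition index_symmetries :: "nat list \<Rightarrow> (nat \<Rightarrow> nat) set" where
  "index_symmetries x = {\<sigma>. \<sigma> permutes {..<length x} \<and> (\<forall>i<length x. x ! \<sigma> i = x ! i)}"

lemma finite_index_symmetries: "finite (index_symmetries x)"
  by (rule finite_subset[OF _ finite_permutations[of "{..<length x}"]]) (auto simp: index_symmetries_def)

lemma card_same_blocks_ge:
  assumes t: "t \<in> start_tuples n (length x)" "separated n (length x) D t" and D: "0 \<le> D"
  shows "card (index_symmetries x) \<le>
    card {u \<in> start_tuples n (length x). separated n (length x) D u \<and> blocks x C u = blocks x C t}"
proof -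
  let ?k = "length x"
  define f where "f = (\<lambda>\<sigma>. \<lambda>i\<in>{..<?k}. t (\<sigma> i))"
  have t_inj: "i = j" if "i < ?k" "j < ?k" "t i = t j" for i j
    using separatedD[OF t(2) that(1,2), of 0] that D by auto
  have lt: "\<sigma> i < ?k" if "\<sigma> \<in> index_symmetries x" "i < ?k" for \<sigma> i
    using that permutes_in_image[of \<sigma> "{..<?k}" i] by (auto simp: index_symmetries_def)
  have "inj_on f (index_symmetries x)"
  proof (rule inj_onI, rule ext)
    fix \<sigma> \<tau> i assume s: "\<sigma> \<in> index_symmetries x" "\<tau> \<in> index_symmetries x" "f \<sigma> = f \<tau>"
    show "\<sigma> i = \<tau> i"
    proof (cases "i < ?k")
      case True
      then have "t (\<sigma> i) = t (\<tau> i)" using fun_cong[OF s(3), of i] by (simp add: f_def)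
      then show ?thesis using t_inj lt s True by blast
    next
      case False
      then have "i \<notin> {..<?k}" by simp
      moreover have "\<sigma> permutes {..<?k}" "\<tau> permutes {..<?k}"
        using s(1,2) by (simp_all add: index_symmetries_def)
      ultimately show ?thesis by (simp add: permutes_not_in)
    qed
  qed
  moreover have "f \<sigma> \<in> {u \<in> start_tuples n ?k. separated n ?k D u \<and> blocks x C u = blocks x C t}"
    if s: "\<sigma> \<in> index_symmetries x" for \<sigma>
  proof -
    have p: "\<sigma> permutes {..<?k}" and xs: "\<And>i. i < ?k \<Longrightarrow> x ! \<sigma> i = x ! i"
      using s by (auto simp: index_symmetries_def)
    have "f \<sigma> \<in> start_tuples n ?k" using t(1) lt[OF s] by (auto simp: f_def start_tuples_def PiE_iff)
    moreover have "separated n ?k D (f \<sigma>)"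
      unfolding separated_def
    proof (intro allI impI)
      fix i j e assume ij: "i < ?k" "j < ?k" "i \<noteq> j" "\<bar>e\<bar> \<le> D"
      then have "\<sigma> i \<noteq> \<sigma> j" using permutes_inj[OF p] by (auto dest: injD)
      then have "\<not> int n dvd t (\<sigma> i) - t (\<sigma> j) - e"
        using ij lt[OF s] by (intro separatedD[OF t(2)]) auto
      then show "\<not> int n dvd f \<sigma> i - f \<sigma> j - e" using ij by (simp add: f_def)
    qed
    moreover have "blocks x C (f \<sigma>) = blocks x C t"
    proof -
      have "blocks x C (f \<sigma>) = (\<Union>i\<in>{..<?k}. C ` {t (\<sigma> i) + 1..t (\<sigma> i) + int (x ! \<sigma> i)})"
        unfolding blocks_def by (intro SUP_cong) (auto simp: f_def xs)
      also have "\<dots> = (\<Union>i\<in>\<sigma> ` {..<?k}. C ` {t i + 1..t i + int (x ! i)})" by simp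
      also have "\<sigma> ` {..<?k} = {..<?k}" using p by (rule permutes_image)
      finally show ?thesis by (simp add: blocks_def)
    qed
    ultimately show ?thesis by simp
  qed
  ultimately show ?thesis by (intro card_inj_on_le) (auto simp: finite_start_tuples)
qed

section \<open>Families that meet every Hamilton cycle\<close>

text \<open>
  A family \<open>F\<close> for which no cycle is acceptable, together with the index \<open>j\<close> of a fixed block of
  length at least \<open>2\<close>.
\<close>
locale blocking_family =
  fixes x :: "nat list" and n :: nat and F :: "nat set set" and j :: nat
  assumes j: "j < length x" "2 \<le> x ! j"
    and large: "2 * sum_list x + 2 < n"
    and family: "F \<subseteq> nsets {1..n} (sum_list x)"
    and blocking: "\<And>C. C \<in> cycles n \<Longrightarrow> \<exists>t. blocks x C t \<in> F"
begin

text \<open>The separated tuples whose blocks form a member of \<open>F\<close> along the cycle \<open>C\<close>.\<close>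
definition hits :: "(int \<Rightarrow> nat) \<Rightarrow> (nat \<Rightarrow> int) set" where
  "hits C = {t \<in> start_tuples n (length x).
     separated n (length x) (2 * int (sum_list x)) t \<and> blocks x C t \<in> F}"

text \<open>
  Pairs of a cycle and a tuple that is badly separated and yet yields a member of \<open>F\<close>. The bound
  \<open>2 * r + 1\<close> here is one more than the one for \<open>hits\<close>, since the rotations move a starting point
  by one.
\<close>
definition exceptional :: "((int \<Rightarrow> nat) \<times> (nat \<Rightarrow> int)) set" where
  "exceptional = (SIGMA C:cycles n. {t \<in> start_tuples n (length x).
     \<not> separated n (length x) (2 * int (sum_list x) + 1) t \<and> blocks x C t \<in> F})"

text \<open>
  Every member of \<open>F\<close> that comes from a separated tuple accounts for at least
  \<open>card (index_symmetries x)\<close> hits, so the cycles that exhibit two different such members are among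
  the following ones.
\<close>
definition multiple :: "(int \<Rightarrow> nat) set" where
  "multiple = {C \<in> cycles n. 2 * card (index_symmetries x) \<le> card (hits C)}"

text \<open>
  The remaining cycles, without those in exceptional pairs. Each of them exhibits exactly one member
  of \<open>F\<close>.
\<close>
definition regular :: "(int \<Rightarrow> nat) set" where
  "regular = cycles n - multiple - fst ` exceptional"

lemma n_pos: "0 < n" using large by simp

lemma finite_hits: "finite (hits C)"
  by (simp add: hits_def finite_start_tuples)

lemma finite_exceptional: "finite exceptional"
  unfolding exceptional_def by (intro finite_SigmaI finite_cycles) (simp add: finite_start_tuples)

lemma hitsI:
  assumes C: "C \<in> cycles n"
    and t: "blocks x C t \<in> F" "separated n (length x) (2 * int (sum_list x)) t"
  obtains u where "u \<in> hits C" "blocks x C u = blocks x C t"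
proof -
  obtain u where u: "u \<in> start_tuples n (length x)" "\<And>i. i < length x \<Longrightarrow> int n dvd t i - u i"
    using start_tuples_reduce[OF n_pos, of "length x" t] by blast
  have "blocks x C u = blocks x C t" using blocks_cong_mod[OF C u(2)] by simp
  moreover have "separated n (length x) (2 * int (sum_list x)) u"
    using t(2) separated_cong_mod[of "length x" n t u] u(2) by simp
  ultimately show thesis using u(1) t(1) by (intro that[of u]) (simp_all add: hits_def)
qed

lemma card_hits_ge:
  assumes "t \<in> hits C"
  shows "card (index_symmetries x) \<le> card {u \<in> hits C. blocks x C u = blocks x C t}"
proof -
  have "card (index_symmetries x) \<le> card {u \<in> start_tuples n (length x).
      separated n (length x) (2 * int (sum_list x)) u \<and> blocks x C u = blocks x C t}"
    using assms by (intro card_same_blocks_ge) (auto simp: hits_def)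
  also have "\<dots> \<le> card {u \<in> hits C. blocks x C u = blocks x C t}"
    using assms by (intro card_mono) (auto simp: hits_def finite_start_tuples)
  finally show ?thesis .
qed

lemma multipleI:
  assumes C: "C \<in> cycles n"
    and t: "blocks x C t \<in> F" "separated n (length x) (2 * int (sum_list x)) t"
    and u: "blocks x C u \<in> F" "separated n (length x) (2 * int (sum_list x)) u"
    and ne: "blocks x C u \<noteq> blocks x C t"
  shows "C \<in> multiple"
proof -
  obtain t' where t': "t' \<in> hits C" "blocks x C t' = blocks x C t" by (rule hitsI[OF C t])
  obtain u' where u': "u' \<in> hits C" "blocks x C u' = blocks x C u" by (rule hitsI[OF C u])
  let ?A = "{v \<in> hits C. blocks x C v = blocks x C t}"
  let ?B = "{v \<in> hits C. blocks x C v = blocks x C u}"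
  have "2 * card (index_symmetries x) \<le> card ?A + card ?B"
    using card_hits_ge[OF t'(1)] card_hits_ge[OF u'(1)] t'(2) u'(2) by simp
  also have "\<dots> = card (?A \<union> ?B)"
    using ne by (intro card_Un_disjoint[symmetric]) (auto simp: finite_hits)
  also have "\<dots> \<le> card (hits C)" by (intro card_mono finite_hits) auto
  finally show ?thesis using C by (simp add: multiple_def)
qed

lemma not_exceptional_separated:
  assumes C: "C \<in> cycles n" "C \<notin> fst ` exceptional" and t: "blocks x C t \<in> F"
  shows "separated n (length x) (2 * int (sum_list x) + 1) t"
proof (rule ccontr)
  assume ns: "\<not> ?thesis"
  obtain u where u: "u \<in> start_tuples n (length x)" "\<And>i. i < length x \<Longrightarrow> int n dvd t i - u i"
    using start_tuples_reduce[OF n_pos, of "length x" t] by blast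
  have "blocks x C u \<in> F" using blocks_cong_mod[OF C(1) u(2)] t by simp
  moreover have "\<not> separated n (length x) (2 * int (sum_list x) + 1) u"
    using ns separated_cong_mod[of "length x" n t u] u(2) by simp
  ultimately have "(C, u) \<in> exceptional" using C u by (simp add: exceptional_def)
  then show False using C(2) by force
qed

lemma regular_hits:
  assumes "C \<in> regular"
  shows "C \<in> cycles n" and "card (index_symmetries x) \<le> card (hits C)"
    and "card (hits C) < 2 * card (index_symmetries x)"
    and "\<And>t u. blocks x C t \<in> F \<Longrightarrow> blocks x C u \<in> F \<Longrightarrow> blocks x C u = blocks x C t"
proof -
  show C: "C \<in> cycles n" using assms by (simp add: regular_def)
  show "card (hits C) < 2 * card (index_symmetries x)"
    using assms C by (simp add: regular_def multiple_def not_le)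
  have sep: "separated n (length x) (2 * int (sum_list x)) t" if "blocks x C t \<in> F" for t
  proof -
    have "separated n (length x) (2 * int (sum_list x) + 1) t"
      using not_exceptional_separated[OF C _ that] assms by (simp add: regular_def)
    then show ?thesis by (rule separated_mono) simp
  qed
  show "blocks x C u = blocks x C t" if "blocks x C t \<in> F" "blocks x C u \<in> F" for t u
    using multipleI[OF C that(1) sep[OF that(1)] that(2) sep[OF that(2)]] assms
    by (auto simp: regular_def)
  obtain t where t: "blocks x C t \<in> F" using blocking[OF C] by blast
  obtain u where "u \<in> hits C" by (rule hitsI[OF C t sep[OF t]])
  from card_hits_ge[OF this] show "card (index_symmetries x) \<le> card (hits C)"
    by (rule order_trans) (intro card_mono finite_hits, auto)
qed

text \<open>
  Hits on regular cycles, sorted by the badly separated tuple \<open>t'\<close> that appears after the swap of the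
  two vertices at the start of the \<open>j\<close>-th block. The numbers \<open>i\<close> and \<open>b\<close> record where the
  intervals of \<open>t'\<close> touch the swapped pair. Together with \<open>t'\<close> they determine \<open>t j\<close>, hence
  the swap, and so the original cycle from the swapped cycle \<open>C'\<close>.
\<close>
definition swap_group :: "((int \<Rightarrow> nat) \<times> (nat \<Rightarrow> int)) \<times> nat \<times> nat \<Rightarrow> ((int \<Rightarrow> nat) \<times> (nat \<Rightarrow> int)) set" where
  "swap_group = (\<lambda>((C', t'), i, b). {(C, t). C \<in> regular \<and> t \<in> hits C \<and>
     t j = (t' i + int b) mod int n \<and> C \<circ> rot n (t j) 1 = C'})"

lemma regular_hit_cases:
  defines "l \<equiv> int (x ! j)"
  assumes C: "C \<in> regular" and t: "t \<in> hits C"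
  shows "(\<exists>e\<in>exceptional. \<exists>i<length x. \<exists>b\<le>sum_list x. (C, t) \<in> swap_group (e, i, b)) \<or>
    C \<circ> rot n (t j) l \<in> multiple \<and> t(j := (t j - 1) mod int n) \<in> hits (C \<circ> rot n (t j) l) \<or>
    C \<circ> rot n (t j + 1) (l - 1) \<in> multiple \<and> t \<in> hits (C \<circ> rot n (t j + 1) (l - 1))"
proof -
  let ?R = "int (sum_list x)" and ?q = "t j"
  note C' = regular_hits[OF C]
  have Cc: "C \<in> cycles n" by (rule C'(1))
  have tF: "blocks x C t \<in> F" and tb: "t \<in> start_tuples n (length x)" using t by (auto simp: hits_def)
  have l: "2 \<le> l" "l \<le> ?R" using j elem_le_sum_list[OF j(1)] by (auto simp: l_def)
  have cyc: "C \<circ> rot n p m \<in> cycles n" if "0 \<le> m" "m \<le> l" for p m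
    using comp_rot_in_cycles[OF Cc] that l large by simp
  have sep: "separated n (length x) (2 * ?R + 1) t"
    using not_exceptional_separated[OF Cc _ tF] C by (simp add: regular_def)
  have sep0: "separated n (length x) (2 * ?R) t"
    and sep1: "separated n (length x) (2 * ?R) (t(j := ?q - 1))"
    using separated_mono[OF sep, of "2 * ?R"] separated_shift[OF sep, of "- 1" j] by auto
  define u where "u = t(j := (?q - 1) mod int n)"
  have u_mod: "int n dvd (t(j := ?q - 1)) i - u i" for i
    by (simp add: u_def dvd_minus_mod)
  have ub: "u \<in> start_tuples n (length x)"
    using tb n_pos j(1) by (auto simp: u_def start_tuples_def PiE_iff extensional_def)
  obtain t' where t': "blocks x (C \<circ> rot n ?q 1) t' \<in> F" using blocking cyc[of 1 ?q] l by auto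
  have key: "\<exists>i<length x. \<exists>b\<le>sum_list x. int n dvd ?q - (t' i + int b)"
    "separated n (length x) (2 * ?R + 1) t' \<Longrightarrow>
      blocks x (C \<circ> rot n ?q l) (t(j := ?q - 1)) = blocks x C t \<and>
        (\<exists>t''. separated n (length x) (2 * ?R) t'' \<and>
          blocks x (C \<circ> rot n ?q l) t'' \<in> F - {blocks x C t}) \<or>
      blocks x (C \<circ> rot n (?q + 1) (l - 1)) t = blocks x C t \<and>
        (\<exists>t''. separated n (length x) (2 * ?R) t'' \<and>
          blocks x (C \<circ> rot n (?q + 1) (l - 1)) t'' \<in> F - {blocks x C t})"
    using second_blocks[OF Cc, of x j l ?q t F t'] j large l sep C'(4)[OF tF] t' by (auto simp: l_def)
  show ?thesis
  proof (cases "separated n (length x) (2 * ?R + 1) t'")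
    case True
    from key(2)[OF this] show ?thesis
    proof (elim disjE conjE exE)
      fix t'' assume 1: "blocks x (C \<circ> rot n ?q l) (t(j := ?q - 1)) = blocks x C t"
        and 2: "separated n (length x) (2 * ?R) t''"
        and 3: "blocks x (C \<circ> rot n ?q l) t'' \<in> F - {blocks x C t}"
      have "C \<circ> rot n ?q l \<in> multiple"
        using multipleI[OF cyc[of l ?q], of "t(j := ?q - 1)" t''] 1 2 3 sep1 tF l by auto
      moreover have "u \<in> hits (C \<circ> rot n ?q l)"
      proof -
        have "blocks x (C \<circ> rot n ?q l) (t(j := ?q - 1)) = blocks x (C \<circ> rot n ?q l) u"
          using l by (intro blocks_cong_mod[where n = n] cyc u_mod) auto
        moreover have "separated n (length x) (2 * ?R) u"
          using separated_cong_mod[of "length x" n "t(j := ?q - 1)" u, OF u_mod] sep1 by blast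
        ultimately show ?thesis using 1 tF ub by (simp add: hits_def)
      qed
      ultimately show ?thesis by (simp add: u_def)
    next
      fix t'' assume 1: "blocks x (C \<circ> rot n (?q + 1) (l - 1)) t = blocks x C t"
        and 2: "separated n (length x) (2 * ?R) t''"
        and 3: "blocks x (C \<circ> rot n (?q + 1) (l - 1)) t'' \<in> F - {blocks x C t}"
      have "C \<circ> rot n (?q + 1) (l - 1) \<in> multiple"
        using multipleI[OF cyc[of "l - 1" "?q + 1"], of t t''] 1 2 3 sep0 tF l by auto
      moreover have "t \<in> hits (C \<circ> rot n (?q + 1) (l - 1))"
        using 1 tF tb sep0 by (simp add: hits_def)
      ultimately show ?thesis by simp
    qed
  next
    case False
    obtain i b where ib: "i < length x" "b \<le> sum_list x" "int n dvd ?q - (t' i + int b)"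
      using key(1) by blast
    obtain v where v: "v \<in> start_tuples n (length x)" "\<And>i. i < length x \<Longrightarrow> int n dvd t' i - v i"
      using start_tuples_reduce[OF n_pos, of "length x" t'] by blast
    have "blocks x (C \<circ> rot n ?q 1) v \<in> F"
      using blocks_cong_mod[OF cyc[of 1 ?q] v(2)] t' l by simp
    moreover have "\<not> separated n (length x) (2 * ?R + 1) v"
      using False separated_cong_mod[of "length x" n t' v] v(2) by simp
    ultimately have e: "(C \<circ> rot n ?q 1, v) \<in> exceptional"
      using cyc[of 1 ?q] l v(1) by (simp add: exceptional_def)
    have "int n dvd (?q - (t' i + int b)) + (t' i - v i)" using ib v by (intro dvd_add) auto
    then have "?q mod int n = (v i + int b) mod int n" by (simp add: mod_eq_dvd_iff algebra_simps)
    then have "?q = (v i + int b) mod int n" using start_tuples_mod[OF tb j(1)] by simp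
    then have "(C, t) \<in> swap_group ((C \<circ> rot n ?q 1, v), i, b)"
      using C t by (simp add: swap_group_def)
    then show ?thesis using e ib by blast
  qed
qed

lemma swap_group_bound:
  "finite (swap_group p)" "card (swap_group p) \<le> 2 * card (index_symmetries x)"
proof -
  obtain C' t' i b where p: "p = ((C', t'), i, b)" by (metis prod.collapse)
  define q where "q = (t' i + int b) mod int n"
  have eq: "swap_group p = {(C, t). C \<in> regular \<and> t \<in> hits C \<and> t j = q \<and> C \<circ> rot n q 1 = C'}"
    by (auto simp: swap_group_def p q_def)
  have "finite (swap_group p) \<and> card (swap_group p) \<le> 2 * card (index_symmetries x)"
  proof (cases "swap_group p = {}")
    case False
    then obtain C t where C: "C \<in> regular" "C \<circ> rot n q 1 = C'" unfolding eq by auto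
    have "D = C" if "D \<circ> rot n q 1 = C'" for D
      using comp_rot_inject[of D n q 1 C] that C(2) large by simp
    then have sub: "swap_group p \<subseteq> Pair C ` hits C" unfolding eq by auto
    have "card (swap_group p) \<le> card (Pair C ` hits C)" using sub finite_hits by (intro card_mono) auto
    also have "\<dots> \<le> card (hits C)" using finite_hits by (rule card_image_le)
    also have "\<dots> \<le> 2 * card (index_symmetries x)" using regular_hits(3)[OF C(1)] by simp
    finally show ?thesis using sub finite_hits finite_subset by blast
  qed simp
  then show "finite (swap_group p)" "card (swap_group p) \<le> 2 * card (index_symmetries x)" by auto
qed

lemma finite_hit_pairs: "X \<subseteq> cycles n \<Longrightarrow> finite (SIGMA C:X. hits C)"
  using finite_cycles finite_subset finite_hits by blast

text \<open>
  Both rotations of \<open>second_blocks\<close> are injective on pairs of a cycle and a tuple, because the tuple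
  that comes out still tells which window was rotated. So, up to the exceptional pairs, the hits on regular
  cycles are at most twice as many as the hits on cycles with multiple members of \<open>F\<close>.
\<close>
lemma card_regular_hits_le:
  "card (SIGMA C:regular. hits C) \<le> 2 * card (SIGMA C:multiple. hits C)
     + 2 * card (index_symmetries x) * (length x * (sum_list x + 1)) * card exceptional"
proof -
  let ?A = "SIGMA C:regular. hits C" and ?W = "SIGMA C:multiple. hits C"
  let ?I = "exceptional \<times> {..<length x} \<times> {..sum_list x}"
  define l where "l = int (x ! j)"
  have l: "2 \<le> l" "l < int n" using j elem_le_sum_list[OF j(1)] large by (auto simp: l_def)
  define f1 :: "(int \<Rightarrow> nat) \<times> (nat \<Rightarrow> int) \<Rightarrow> (int \<Rightarrow> nat) \<times> (nat \<Rightarrow> int)"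
    where "f1 = (\<lambda>(C, t). (C \<circ> rot n (t j) l, t(j := (t j - 1) mod int n)))"
  define f2 :: "(int \<Rightarrow> nat) \<times> (nat \<Rightarrow> int) \<Rightarrow> (int \<Rightarrow> nat) \<times> (nat \<Rightarrow> int)"
    where "f2 = (\<lambda>(C, t). (C \<circ> rot n (t j + 1) (l - 1), t))"
  have regc: "regular \<subseteq> cycles n" and mulc: "multiple \<subseteq> cycles n"
    by (auto simp: regular_def multiple_def)
  have finA: "finite ?A" and finW: "finite ?W" using finite_hit_pairs regc mulc by auto
  have inj1: "inj_on f1 ?A"
  proof (rule inj_onI)
    fix p p' assume p: "p \<in> ?A" and p': "p' \<in> ?A" and eq: "f1 p = f1 p'"
    obtain C t C' t' where q: "p = (C, t)" "p' = (C', t')" by (metis prod.collapse)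
    have t: "t \<in> start_tuples n (length x)" "t' \<in> start_tuples n (length x)"
      using p p' by (auto simp: q hits_def)
    have e1: "C \<circ> rot n (t j) l = C' \<circ> rot n (t' j) l"
      and e2: "t(j := (t j - 1) mod int n) = t'(j := (t' j - 1) mod int n)"
      using eq by (auto simp: q f1_def)
    have "(t j - 1) mod int n = (t' j - 1) mod int n" using fun_cong[OF e2, of j] by simp
    then have "t j mod int n = t' j mod int n" by (simp add: mod_eq_dvd_iff)
    then have tj: "t j = t' j" using start_tuples_mod[OF t(1) j(1)] start_tuples_mod[OF t(2) j(1)] by simp
    have "t i = t' i" for i using fun_cong[OF e2, of i] tj by (cases "i = j") auto
    then have "t = t'" by blast
    moreover have "C = C'" using comp_rot_inject[of C n "t j" l C'] e1 tj l by simp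
    ultimately show "p = p'" by (simp add: q)
  qed
  have inj2: "inj_on f2 ?A"
  proof (rule inj_onI)
    fix p p' assume eq: "f2 p = f2 p'"
    obtain C t C' t' where q: "p = (C, t)" "p' = (C', t')" by (metis prod.collapse)
    have "t = t'" "C \<circ> rot n (t j + 1) (l - 1) = C' \<circ> rot n (t j + 1) (l - 1)"
      using eq by (auto simp: q f2_def)
    then show "p = p'" using comp_rot_inject[of C n "t j + 1" "l - 1" C'] l by (simp add: q)
  qed
  have part: "card {p \<in> ?A. f p \<in> ?W} \<le> card ?W" if "inj_on f ?A" for f
    using that finW by (intro card_inj_on_le[of f]) (auto simp: inj_on_def)
  have "?A \<subseteq> {p \<in> ?A. f1 p \<in> ?W} \<union> {p \<in> ?A. f2 p \<in> ?W} \<union> (\<Union>p\<in>?I. swap_group p)"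
  proof
    fix p assume p: "p \<in> ?A"
    then obtain C t where q: "p = (C, t)" "C \<in> regular" "t \<in> hits C" by auto
    from regular_hit_cases[OF q(2,3)]
    consider e i b where "e \<in> exceptional" "i < length x" "b \<le> sum_list x" "p \<in> swap_group (e, i, b)"
      | "f1 p \<in> ?W" | "f2 p \<in> ?W"
      unfolding f1_def f2_def q(1) l_def by auto
    then show "p \<in> {p \<in> ?A. f1 p \<in> ?W} \<union> {p \<in> ?A. f2 p \<in> ?W} \<union> (\<Union>p\<in>?I. swap_group p)"
    proof cases
      case 1
      then have "(e, i, b) \<in> ?I" by simp
      then show ?thesis using 1(4) by blast
    qed (use p in blast)+
  qed
  then have "card ?A \<le> card ({p \<in> ?A. f1 p \<in> ?W} \<union> {p \<in> ?A. f2 p \<in> ?W} \<union> (\<Union>p\<in>?I. swap_group p))"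
    using finA finite_exceptional swap_group_bound(1) by (intro card_mono) auto
  also have "\<dots> \<le> card {p \<in> ?A. f1 p \<in> ?W} + card {p \<in> ?A. f2 p \<in> ?W} + card (\<Union>p\<in>?I. swap_group p)"
    by (meson add_le_mono card_Un_le le_refl order_trans)
  also have "card (\<Union>p\<in>?I. swap_group p) \<le> (\<Sum>p\<in>?I. card (swap_group p))"
    using finite_exceptional by (intro card_UN_le) auto
  also have "\<dots> \<le> of_nat (card ?I) * (2 * card (index_symmetries x))"
    by (intro sum_bounded_above swap_group_bound)
  also have "of_nat (card ?I) * (2 * card (index_symmetries x)) =
      2 * card (index_symmetries x) * (length x * (sum_list x + 1)) * card exceptional"
    by (simp add: card_cartesian_product algebra_simps)
  finally show ?thesis using part[OF inj1] part[OF inj2] by linarith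
qed

text \<open>
  With \<open>a\<close> and \<open>w\<close> the numbers of hits on regular and on multiple cycles, and up to exceptional
  pairs, \<open>a \<le> 2 * w\<close> and \<open>2 * s * N \<le> 2 * a + w\<close> for the number \<open>N\<close> of all cycles, hence
  \<open>6 * s * N \<le> 6 * a + 3 * w \<le> 5 * (a + w)\<close>.
\<close>
lemma card_hits_total_ge:
  defines "s \<equiv> card (index_symmetries x)"
  shows "6 * s * card (cycles n) \<le> 5 * card (SIGMA C:cycles n. hits C)
     + (2 * s * (length x * (sum_list x + 1)) + 6 * s) * card exceptional"
proof -
  let ?A = "SIGMA C:regular. hits C" and ?W = "SIGMA C:multiple. hits C"
  have regc: "regular \<subseteq> cycles n" and mulc: "multiple \<subseteq> cycles n" and disj: "regular \<inter> multiple = {}"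
    by (auto simp: regular_def multiple_def)
  have fin: "finite regular" "finite multiple" 
    using finite_subset[OF regc finite_cycles] finite_subset[OF mulc finite_cycles] by simp_all
  have A: "s * card regular \<le> card ?A"
  proof -
    have "of_nat (card regular) * s \<le> (\<Sum>C\<in>regular. card (hits C))"
      unfolding s_def by (intro sum_bounded_below regular_hits(2))
    then show ?thesis using fin finite_hits by (simp add: card_SigmaI mult.commute)
  qed
  have W: "2 * s * card multiple \<le> card ?W"
  proof -
    have "of_nat (card multiple) * (2 * s) \<le> (\<Sum>C\<in>multiple. card (hits C))"
      unfolding s_def by (intro sum_bounded_below) (auto simp: multiple_def)
    then show ?thesis using fin finite_hits by (simp add: card_SigmaI mult.commute)
  qed
  have "card ?A + card ?W = card (?A \<union> ?W)"
    using finite_hit_pairs regc mulc disj by (intro card_Un_disjoint[symmetric]) auto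
  also have "\<dots> \<le> card (SIGMA C:cycles n. hits C)"
    using finite_hit_pairs regc mulc by (intro card_mono) auto
  finally have S: "card ?A + card ?W \<le> card (SIGMA C:cycles n. hits C)" .
  have "cycles n \<subseteq> regular \<union> multiple \<union> fst ` exceptional" by (auto simp: regular_def)
  then have "card (cycles n) \<le> card (regular \<union> multiple \<union> fst ` exceptional)"
    using fin finite_exceptional by (intro card_mono) auto
  also have "\<dots> \<le> card regular + card multiple + card (fst ` exceptional)"
    by (meson add_le_mono card_Un_le le_refl order_trans)
  also have "card (fst ` exceptional) \<le> card exceptional"
    using finite_exceptional by (rule card_image_le)
  finally have "card (cycles n) \<le> card regular + card multiple + card exceptional" by simp
  then have "6 * s * card (cycles n) \<le> 6 * s * (card regular + card multiple + card exceptional)"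
    by (rule mult_le_mono2)
  then have N: "6 * s * card (cycles n) \<le> 6 * (s * card regular) + 3 * (2 * s * card multiple)
      + 6 * s * card exceptional"
    by (simp add: algebra_simps)
  have "card ?A \<le> 2 * card ?W + 2 * s * (length x * (sum_list x + 1)) * card exceptional"
    using card_regular_hits_le by (simp add: s_def)
  moreover have "(2 * s * (length x * (sum_list x + 1)) + 6 * s) * card exceptional =
      2 * s * (length x * (sum_list x + 1)) * card exceptional + 6 * s * card exceptional"
    by (simp only: add_mult_distrib)
  ultimately show ?thesis using A W S N by linarith
qed

lemma card_pairs_le:
  assumes "T \<subseteq> start_tuples n (length x)"
  shows "card (SIGMA C:cycles n. {t \<in> T. blocks x C t \<in> F}) * (n choose sum_list x)
    \<le> card T * (card F * card (cycles n))"
proof -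
  let ?S = "SIGMA C:cycles n. {t \<in> T. blocks x C t \<in> F}"
  let ?S' = "SIGMA t:T. {C \<in> cycles n. blocks x C t \<in> F}"
  have finT: "finite T" using assms finite_start_tuples finite_subset by blast
  have "card ?S = card ?S'"
    by (rule bij_betw_same_card[of prod.swap]) (auto simp: bij_betw_def inj_on_def image_iff)
  also have "\<dots> = (\<Sum>t\<in>T. card {C \<in> cycles n. blocks x C t \<in> F})"
    using finT finite_cycles by (intro card_SigmaI) auto
  finally have "card ?S * (n choose sum_list x) =
      (\<Sum>t\<in>T. card {C \<in> cycles n. blocks x C t \<in> F} * (n choose sum_list x))"
    by (simp add: sum_distrib_right)
  also have "\<dots> \<le> of_nat (card T) * (card F * card (cycles n))"
  proof (rule sum_bounded_above)
    fix t
    have "blocks x C t = C ` (\<Union>i<length x. {t i + 1..t i + int (x ! i)})" for C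
      by (simp add: blocks_def image_UN)
    then show "card {C \<in> cycles n. blocks x C t \<in> F} * (n choose sum_list x) \<le> card F * card (cycles n)"
      using card_cycles_image_le[OF family] by simp
  qed
  finally show ?thesis by simp
qed

lemma card_family_ge:
  defines "s \<equiv> card (index_symmetries x)" and "k \<equiv> length x" and "r \<equiv> sum_list x"
  shows "6 * s * (n choose r) \<le>
    (5 * n ^ k + (2 * s * (k * (r + 1)) + 6 * s) * (k * k * (4 * r + 3)) * n ^ (k - 1)) * card F"
proof -
  let ?N = "card (cycles n)" and ?b = "n choose r"
  let ?K = "2 * s * (k * (r + 1)) + 6 * s"
  have S: "card (SIGMA C:cycles n. hits C) * ?b \<le> n ^ k * (card F * ?N)"
  proof -
    let ?T = "{t \<in> start_tuples n k. separated n k (2 * int r) t}"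
    have "card (SIGMA C:cycles n. hits C) * ?b \<le> card ?T * (card F * ?N)"
      using card_pairs_le[of ?T] by (simp add: hits_def k_def r_def conj_ac)
    also have "card ?T \<le> card (start_tuples n k)"
      by (intro card_mono finite_start_tuples) auto
    finally show ?thesis by (simp add: card_start_tuples)
  qed
  have E: "card exceptional * ?b \<le> (k * k * (4 * r + 3)) * n ^ (k - 1) * (card F * ?N)"
  proof -
    let ?T = "{t \<in> start_tuples n k. \<not> separated n k (int (2 * r + 1)) t}"
    have "exceptional = (SIGMA C:cycles n. {t \<in> ?T. blocks x C t \<in> F})"
      by (auto simp: exceptional_def k_def r_def add.commute)
    then have "card exceptional * ?b \<le> card ?T * (card F * ?N)"
      using card_pairs_le[of ?T] by (simp add: k_def r_def)
    also have "card ?T \<le> k * k * (2 * (2 * r + 1) + 1) * n ^ (k - 1)"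
      by (rule card_not_separated_le)
    finally show ?thesis by (simp add: algebra_simps)
  qed
  have "6 * s * ?b * ?N \<le> (5 * card (SIGMA C:cycles n. hits C) + ?K * card exceptional) * ?b"
    using mult_le_mono1[OF card_hits_total_ge, of ?b] by (simp add: s_def k_def r_def mult_ac)
  also have "\<dots> = 5 * (card (SIGMA C:cycles n. hits C) * ?b) + ?K * (card exceptional * ?b)"
    by (simp add: algebra_simps)
  also have "\<dots> \<le> 5 * (n ^ k * (card F * ?N)) + ?K * ((k * k * (4 * r + 3)) * n ^ (k - 1) * (card F * ?N))"
    using S E by (intro add_mono mult_le_mono2) auto
  also have "\<dots> = (5 * n ^ k + ?K * (k * k * (4 * r + 3)) * n ^ (k - 1)) * card F * ?N"
    by (simp add: algebra_simps)
  finally show ?thesis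
    using cycles_nonempty[OF n_pos] finite_cycles by (simp add: card_gt_0_iff)
qed

end

section \<open>Counting partitions into blocks of prescribed sizes\<close>

text \<open>
  An ordered partition of \<open>{1..r}\<close> into blocks of sizes \<open>x ! 0, x ! 1, \<dots>\<close> is a word \<open>w\<close> of length
  \<open>r\<close> in which the letter \<open>i\<close> occurs \<open>x ! i\<close> times. There are \<open>r! / \<Prod>i. (x ! i)!\<close> such
  words, and words with the same underlying unordered partition differ by an index symmetry.
\<close>
lemma fact_le_num_partitions:
  assumes pos: "\<And>i. i < length x \<Longrightarrow> 0 < x ! i"
  shows "fact (sum_list x) \<le>
    num_partitions x * card (index_symmetries x) * (\<Prod>i<length x. fact (x ! i))"
proof -
  let ?k = "length x" and ?r = "sum_list x"
  define M where "M = (\<Sum>i<?k. replicate_mset (x ! i) i)"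
  define W where "W = permutations_of_multiset M"
  define part where "part w i = {p \<in> {1..?r}. w ! (p - 1) = i}" for w :: "nat list" and i
  define parts where "parts w = part w ` {..<?k}" for w
  let ?Ps = "{P. partition_on {1..?r} P \<and> image_mset card (mset_set P) = mset x}"
  have count: "count M i = (if i < ?k then x ! i else 0)" for i
    by (simp add: M_def count_sum)
  have set_M: "set_mset M = {..<?k}" using pos count by (force simp: set_mset_def)
  have size_M: "size M = ?r"
  proof -
    have "size M = (\<Sum>i<?k. x ! i)" unfolding M_def by (induction "?k") auto
    then show ?thesis by (simp add: sum_list_sum_nth atLeast0LessThan)
  qed
  have fin_W: "finite W" by (simp add: W_def)
  have fact_eq: "fact ?r = card W * (\<Prod>i<?k. fact (x ! i))"
  proof -
    have "card W * (\<Prod>i\<in>set_mset M. fact (count M i)) = fact (size M)"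
      unfolding W_def by (rule card_permutations_of_multiset_aux)
    moreover have "(\<Prod>i\<in>set_mset M. fact (count M i)) = (\<Prod>i<?k. fact (x ! i) :: nat)"
      unfolding set_M by (intro prod.cong) (auto simp: count)
    ultimately show ?thesis by (simp add: size_M)
  qed
  have len: "length w = ?r" if "w \<in> W" for w
    using that size_M by (metis W_def permutations_of_multisetD size_mset)
  have nth: "w ! p < ?k" if "w \<in> W" "p < ?r" for w p
  proof -
    have "w ! p \<in> set w" using that len by simp
    also have "set w = {..<?k}" using that set_M by (metis W_def permutations_of_multisetD set_mset_mset)
    finally show ?thesis by simp
  qed
  have card_part: "card (part w i) = x ! i" if w: "w \<in> W" "i < ?k" for w i
  proof -
    have "part w i = Suc ` {p. p < length w \<and> w ! p = i}"
    proof (intro equalityI subsetI)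
      fix p assume "p \<in> part w i"
      then show "p \<in> Suc ` {p. p < length w \<and> w ! p = i}"
        using len[OF w(1)] by (intro image_eqI[of _ _ "p - 1"]) (auto simp: part_def)
    qed (auto simp: part_def len[OF w(1)])
    then have "card (part w i) = card {p. p < length w \<and> w ! p = i}" by (simp add: card_image)
    also have "\<dots> = count (mset w) i" by (simp add: count_mset count_list_eq_length_filter length_filter_conv_card eq_commute)
    also have "mset w = M" using w by (simp add: W_def permutations_of_multisetD)
    finally show ?thesis using w count by simp
  qed
  have inj_part: "inj_on (part w) {..<?k}" if w: "w \<in> W" for w
  proof (rule inj_onI)
    fix i j assume ij: "i \<in> {..<?k}" "j \<in> {..<?k}" "part w i = part w j"
    then have "part w i \<noteq> {}" using card_part[OF w, of i] pos[of i] by auto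
    then show "i = j" using ij(3) by (auto simp: part_def)
  qed
  have parts_in: "parts w \<in> ?Ps" if w: "w \<in> W" for w
  proof -
    have "partition_on {1..?r} (parts w)"
    proof (rule partition_onI)
      show "\<Union> (parts w) = {1..?r}"
        using nth[OF w] by (fastforce simp: parts_def part_def)
      show "disjnt p q" if "p \<in> parts w" "q \<in> parts w" "p \<noteq> q" for p q
        using that by (auto simp: parts_def part_def disjnt_def)
      show "{} \<notin> parts w"
      proof
        assume "{} \<in> parts w"
        then obtain i where "i < ?k" "part w i = {}" by (auto simp: parts_def)
        then show False using card_part[OF w, of i] pos[of i] by simp
      qed
    qed
    moreover have "image_mset card (mset_set (parts w)) = mset x"
    proof -
      have "image_mset card (mset_set (parts w)) = image_mset (\<lambda>i. card (part w i)) (mset_set {..<?k})"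
        using inj_part[OF w] by (simp add: parts_def image_mset_mset_set[symmetric] multiset.map_comp comp_def)
      also have "\<dots> = image_mset ((!) x) (mset_set {..<?k})"
        using card_part[OF w] by (intro image_mset_cong) auto
      also have "\<dots> = mset (map ((!) x) [0..<?k])" by (simp add: mset_upt atLeast0LessThan)
      also have "\<dots> = mset x" by (simp only: map_nth)
      finally show ?thesis .
    qed
    ultimately show ?thesis by simp
  qed
  have fibre: "card {w \<in> W. parts w = P} \<le> card (index_symmetries x)" for P
  proof (cases "{w \<in> W. parts w = P} = {}")
    case False
    then obtain v where v: "v \<in> W" "parts v = P" by blast
    have "{w \<in> W. parts w = P} \<subseteq> (\<lambda>\<sigma>. map \<sigma> v) ` index_symmetries x"
    proof
      fix w assume "w \<in> {w \<in> W. parts w = P}"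
      then have w: "w \<in> W" "parts w = P" by auto
      define \<sigma> where "\<sigma> i = (if i < ?k then inv_into {..<?k} (part w) (part v i) else i)" for i
      have mem: "part v i \<in> part w ` {..<?k}" if "i < ?k" for i
        using v(2) w(2) that by (auto simp: parts_def)
      have part: "part w (\<sigma> i) = part v i" if "i < ?k" for i
        using f_inv_into_f[OF mem[OF that]] that by (simp add: \<sigma>_def)
      have lt: "\<sigma> i < ?k" if "i < ?k" for i
        using inv_into_into[OF mem[OF that]] that by (simp add: \<sigma>_def)
      have "inj_on \<sigma> {..<?k}"
      proof (rule inj_onI)
        fix a b assume "a \<in> {..<?k}" "b \<in> {..<?k}" "\<sigma> a = \<sigma> b"
        then show "a = b" using part inj_part[OF v(1)] by (metis inj_onD lessThan_iff)
      qed
      moreover have "\<sigma> ` {..<?k} \<subseteq> {..<?k}" using lt by auto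
      ultimately have "bij_betw \<sigma> {..<?k} {..<?k}" by (simp add: bij_betw_def endo_inj_surj)
      then have "\<sigma> permutes {..<?k}" by (rule bij_imp_permutes) (simp add: \<sigma>_def)
      moreover have "x ! \<sigma> i = x ! i" if "i < ?k" for i
        using card_part[OF w(1) lt[OF that]] card_part[OF v(1) that] part[OF that] by simp
      ultimately have "\<sigma> \<in> index_symmetries x" by (simp add: index_symmetries_def)
      moreover have "w = map \<sigma> v"
      proof (rule nth_equalityI)
        fix p assume "p < length w"
        then have p: "p < ?r" using len[OF w(1)] by simp
        have "Suc p \<in> part v (v ! p)" using p by (simp add: part_def)
        then have "Suc p \<in> part w (\<sigma> (v ! p))" using part nth[OF v(1) p] by simp
        then show "w ! p = map \<sigma> v ! p" using p len[OF v(1)] by (simp add: part_def)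
      qed (simp add: len v w)
      ultimately show "w \<in> (\<lambda>\<sigma>. map \<sigma> v) ` index_symmetries x" by blast
    qed
    then show ?thesis by (rule surj_card_le[OF finite_index_symmetries])
  next
    case True
    show ?thesis unfolding True by simp
  qed
  have fin_Ps: "finite ?Ps"
    by (rule finite_subset[OF _ finitely_many_partition_on[of "{1..?r}"]]) auto
  have "W = (\<Union>P\<in>?Ps. {w \<in> W. parts w = P})" using parts_in by blast
  then have "card W \<le> (\<Sum>P\<in>?Ps. card {w \<in> W. parts w = P})"
    using card_UN_le[OF fin_Ps, of "\<lambda>P. {w \<in> W. parts w = P}"] by simp
  also have "\<dots> \<le> of_nat (card ?Ps) * card (index_symmetries x)"
    by (rule sum_bounded_above) (rule fibre)
  finally have "card W \<le> num_partitions x * card (index_symmetries x)"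
    by (simp add: num_partitions_def)
  then show ?thesis unfolding fact_eq by (rule mult_le_mono1)
qed

section \<open>The lower bound\<close>
lemma consecutive_blocks:
  "m \<le> length x \<Longrightarrow>
    (\<Union>i<m. {sum_list (take i x) + 1..sum_list (take i x) + x ! i}) = {1..sum_list (take m x)}"
  for x :: "nat list"
proof (induction m)
  case (Suc m)
  then have "(\<Union>i<Suc m. {sum_list (take i x) + 1..sum_list (take i x) + x ! i}) =
      {1..sum_list (take m x)} \<union> {sum_list (take m x) + 1..sum_list (take m x) + x ! m}"
    by (simp add: lessThan_Suc Un_commute)
  also have "\<dots> = {1..sum_list (take m x) + x ! m}" by auto
  finally show ?case using Suc by (simp add: take_Suc_conv_app_nth)
qed simp

text \<open>
  Blocks placed one right after the other always form a set of size \<open>sum_list x\<close>; hence the family of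
  all sets of this size is blocking, and the infimum in the definition of \<open>min_blocking\<close> is attained.
\<close>
lemma not_acceptable_nsets:
  assumes c: "hamilton_cycle n c" and n: "sum_list x \<le> n" "0 < n"
  shows "\<not> acceptable x n (nsets {1..n} (sum_list x)) c"
proof -
  let ?r = "sum_list x"
  define t where "t i = sum_list (take i x)" for i
  have "cyclic_interval n c (t i) (x ! i) = (\<lambda>j. c (j mod n)) ` {t i + 1..t i + x ! i}" for i
  proof -
    have "{t i + 1..t i + x ! i} = (\<lambda>j. t i + j) ` {1..x ! i}" by simp
    then show ?thesis unfolding cyclic_interval_def by (simp only: image_image)
  qed
  then have "(\<Union>i<length x. cyclic_interval n c (t i) (x ! i)) =
      (\<lambda>j. c (j mod n)) ` (\<Union>i<length x. {t i + 1..t i + x ! i})"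
    by (simp add: image_UN)
  also have "(\<Union>i<length x. {t i + 1..t i + x ! i}) = {1..?r}"
    using consecutive_blocks[of "length x" x] by (simp add: t_def)
  finally have eq: "(\<Union>i<length x. cyclic_interval n c (t i) (x ! i)) = (\<lambda>j. c (j mod n)) ` {1..?r}" .
  have "inj_on (\<lambda>j. j mod n) {1..?r}"
  proof (rule inj_onI)
    fix a b assume ab: "a \<in> {1..?r}" "b \<in> {1..?r}" "a mod n = b mod n"
    have "a mod n = (if a = n then 0 else a)" "b mod n = (if b = n then 0 else b)"
      using ab(1,2) n(1) by auto
    then show "a = b" using ab by (simp split: if_splits)
  qed
  moreover have "inj_on c ((\<lambda>j. j mod n) ` {1..?r})"
  proof (rule inj_on_subset)
    show "inj_on c {..<n}" using c by (simp add: hamilton_cycle_def bij_betw_def)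
    show "(\<lambda>j. j mod n) ` {1..?r} \<subseteq> {..<n}" using n(2) by auto
  qed
  ultimately have "inj_on (\<lambda>j. c (j mod n)) {1..?r}"
    using comp_inj_on[of "\<lambda>j. j mod n" "{1..?r}" c] by (simp add: comp_def)
  then have "card ((\<lambda>j. c (j mod n)) ` {1..?r}) = ?r" by (simp add: card_image)
  moreover have "(\<lambda>j. c (j mod n)) ` {1..?r} \<subseteq> {1..n}"
    using c n bij_betwE[of c "{..<n}" "{1..n}"] by (auto simp: hamilton_cycle_def)
  ultimately have "(\<lambda>j. c (j mod n)) ` {1..?r} \<in> nsets {1..n} ?r" by (simp add: nsets_def)
  then have "(\<Union>i<length x. cyclic_interval n c (t i) (x ! i)) \<in> nsets {1..n} ?r"
    by (simp only: eq)
  then show ?thesis unfolding acceptable_def by blast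
qed

lemma min_blocking_attained:
  assumes "sum_list x \<le> n" "0 < n"
  obtains F where "F \<subseteq> nsets {1..n} (sum_list x)"
    "\<not> (\<exists>c. hamilton_cycle n c \<and> acceptable x n F c)" "card F = min_blocking x n"
proof -
  define \<S> where "\<S> = {F. F \<subseteq> nsets {1..n} (sum_list x) \<and>
    \<not> (\<exists>c. hamilton_cycle n c \<and> acceptable x n F c)}"
  have "nsets {1..n} (sum_list x) \<in> \<S>"
    using not_acceptable_nsets[OF _ assms] by (auto simp: \<S>_def)
  then have "card ` \<S> \<noteq> {}" by blast
  then have "Inf (card ` \<S>) \<in> card ` \<S>" by (rule Inf_nat_def1)
  moreover have "min_blocking x n = Inf (card ` \<S>)"
    unfolding min_blocking_def \<S>_def by (simp only: setcompr_eq_image)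
  ultimately obtain F where F: "F \<in> \<S>" "card F = min_blocking x n" by auto
  show thesis by (rule that[of F]) (use F in \<open>auto simp: \<S>_def\<close>)
qed

lemma min_blocking_ge:
  assumes "j < length x" "2 \<le> x ! j" "2 * sum_list x + 2 < n"
  defines "s \<equiv> card (index_symmetries x)" and "k \<equiv> length x" and "r \<equiv> sum_list x"
  shows "6 * s * (n choose r) \<le>
    (5 * n ^ k + (2 * s * (k * (r + 1)) + 6 * s) * (k * k * (4 * r + 3)) * n ^ (k - 1)) *
      min_blocking x n"
proof -
  obtain F where F: "F \<subseteq> nsets {1..n} (sum_list x)"
    "\<not> (\<exists>c. hamilton_cycle n c \<and> acceptable x n F c)" "card F = min_blocking x n"
    using min_blocking_attained[of x n] assms(3) by auto
  have "\<exists>t. blocks x C t \<in> F" if C: "C \<in> cycles n" for C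
  proof -
    have "hamilton_cycle n (\<lambda>i. C (int i))" using hamilton_cycle_of_cycles[OF C] assms(3) by simp
    then obtain t where "(\<Union>i<length x. cyclic_interval n (\<lambda>i. C (int i)) (t i) (x ! i)) \<in> F"
      using F(2) by (auto simp: acceptable_def)
    then have "blocks x C (\<lambda>i. int (t i)) \<in> F"
      by (simp add: blocks_def cyclic_interval_of_cycles[OF C])
    then show ?thesis by blast
  qed
  then interpret blocking_family x n F j using assms F by unfold_locales auto
  show ?thesis using card_family_ge F(3) by (simp add: s_def k_def r_def)
qed

lemma tendsto_binomial_over_power:
  "(\<lambda>n. real (n choose r) / real n ^ r) \<longlonglongrightarrow> 1 / fact r"
proof -
  have "(\<lambda>n. (\<Prod>i<r. 1 - real i / real n) / fact r) \<longlonglongrightarrow> (\<Prod>i<r. 1 - 0) / fact r"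
    by (intro tendsto_intros lim_const_over_n) simp
  moreover have "\<forall>\<^sub>F n in sequentially. (\<Prod>i<r. 1 - real i / real n) / fact r = real (n choose r) / real n ^ r"
  proof (rule eventually_sequentiallyI[of 1])
    fix n :: nat assume n: "1 \<le> n"
    have "real (n choose r) = (\<Prod>i<r. real n - real i) / fact r"
      by (simp add: binomial_gbinomial gbinomial_prod_rev atLeast0LessThan)
    also have "(\<Prod>i<r. real n - real i) = (\<Prod>i<r. real n * (1 - real i / real n))"
      using n by (intro prod.cong) (auto simp: field_simps)
    also have "\<dots> = real n ^ r * (\<Prod>i<r. 1 - real i / real n)" by (simp add: prod.distrib)
    finally show "(\<Prod>i<r. 1 - real i / real n) / fact r = real (n choose r) / real n ^ r"
      using n by simp
  qed
  ultimately show ?thesis by (simp add: tendsto_cong)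
qed

theorem theorem18:
  fixes x :: "nat list" and k r :: nat
  assumes pos: "\<forall>i<length x. x ! i > 0"
    and not_all_one: "\<not> (\<forall>i<length x. x ! i = 1)"
    and k: "k = length x"
    and r: "r = sum_list x"
  shows "\<exists>\<epsilon> :: nat \<Rightarrow> real. \<epsilon> \<longlonglongrightarrow> 0 \<and>
           (\<forall>n\<ge>r. real (min_blocking x n) \<ge>
              (4 * real k * real r + 1) / (4 * real k * real r) *
              (1 / (real (num_partitions x) * (\<Prod>i<k. fact (x ! i))) + \<epsilon> n) *
              real n ^ (r - k))"
proof -
  obtain j where j: "j < length x" "2 \<le> x ! j"
    using pos not_all_one by (metis One_nat_def Suc_leI le_neq_implies_less numeral_2_eq_2)
  have k1: "1 \<le> k" using j k by simp
  have r2: "2 \<le> r" using j elem_le_sum_list[OF j(1)] r by simp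
  have kr: "k \<le> r"
  proof -
    have "(\<Sum>i<k. 1) \<le> (\<Sum>i<k. x ! i)" using pos k by (intro sum_mono) (auto simp: Suc_leI)
    then show ?thesis by (simp add: r k sum_list_sum_nth atLeast0LessThan)
  qed
  define s where "s = card (index_symmetries x)"
  define K where "K = (2 * s * (k * (r + 1)) + 6 * s) * (k * k * (4 * r + 3))"
  define g where "g n = 6 * real s * (real (n choose r) / real n ^ r) * (real n / (5 * real n + real K))" for n
  define L :: real where "L = 1 / (real (num_partitions x) * (\<Prod>i<k. fact (x ! i)))"
  define \<beta> where "\<beta> = (4 * real k * real r + 1) / (4 * real k * real r)"
  have bound: "g n * real n ^ (r - k) \<le> real (min_blocking x n)" if n: "2 * r + 2 < n" for n
  proof -
    have nk: "real n ^ k = real n * real n ^ (k - 1)" using k1 by (cases k) auto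
    have nr: "real n ^ r = real n * real n ^ (k - 1) * real n ^ (r - k)"
    proof -
      have "real n ^ r = real n ^ k * real n ^ (r - k)" using kr by (simp add: power_add[symmetric])
      then show ?thesis by (simp add: nk)
    qed
    have "6 * s * (n choose r) \<le> (5 * n ^ k + K * n ^ (k - 1)) * min_blocking x n"
      using min_blocking_ge[OF j, of n] n by (simp add: s_def k r K_def)
    then have "real (6 * s * (n choose r)) \<le> real ((5 * n ^ k + K * n ^ (k - 1)) * min_blocking x n)"
      by (rule of_nat_mono)
    then have "6 * real s * real (n choose r) \<le>
        (5 * real n ^ k + real K * real n ^ (k - 1)) * real (min_blocking x n)"
      by simp
    also have "\<dots> = (5 * real n + real K) * real n ^ (k - 1) * real (min_blocking x n)"
      by (simp add: nk algebra_simps)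
    finally have *: "6 * real s * real (n choose r) \<le>
        (5 * real n + real K) * real n ^ (k - 1) * real (min_blocking x n)" .
    have "g n * real n ^ (r - k) = 6 * real s * real (n choose r) / ((5 * real n + real K) * real n ^ (k - 1))"
      using n by (simp add: g_def nr mult_ac)
    also have "\<dots> \<le> real (min_blocking x n)"
      using * n by (simp add: pos_divide_le_eq mult_ac add_pos_nonneg)
    finally show ?thesis .
  qed
  have lim_g: "g \<longlonglongrightarrow> 6 * real s * (1 / fact r) * (1 / 5)"
    unfolding g_def
  proof (intro tendsto_mult tendsto_const tendsto_binomial_over_power)
    have "(\<lambda>n. 1 / (5 + real K / real n)) \<longlonglongrightarrow> 1 / (5 + 0)"
      by (intro tendsto_intros lim_const_over_n) simp
    moreover have "\<forall>\<^sub>F n in sequentially. 1 / (5 + real K / real n) = real n / (5 * real n + real K)"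
      by (rule eventually_sequentiallyI[of 1]) (simp add: field_simps)
    ultimately show "(\<lambda>n. real n / (5 * real n + real K)) \<longlonglongrightarrow> 1 / 5"
      by (simp add: tendsto_cong)
  qed
  have kr8: "8 \<le> 4 * real k * real r"
  proof -
    have "1 * 2 \<le> real k * real r" using k1 r2 by (intro mult_mono) auto
    then show ?thesis by simp
  qed
  have beta: "0 < \<beta>" "\<beta> \<le> 6 / 5" using kr8 by (auto simp: \<beta>_def field_simps)
  have L: "L \<le> real s / fact r"
  proof -
    have "fact r \<le> num_partitions x * s * (\<Prod>i<k. fact (x ! i))"
      using fact_le_num_partitions[of x] pos by (simp add: r k s_def)
    then have "real (fact r) \<le> real (num_partitions x * s * (\<Prod>i<k. fact (x ! i)))"
      by (rule of_nat_mono)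
    then have *: "fact r \<le> real s * (real (num_partitions x) * (\<Prod>i<k. fact (x ! i)))"
      by (simp add: mult_ac)
    have "0 < real (num_partitions x) * (\<Prod>i<k. fact (x ! i))"
    proof (rule ccontr)
      assume "\<not> ?thesis"
      then have "real s * (real (num_partitions x) * (\<Prod>i<k. fact (x ! i))) \<le> 0"
        by (intro mult_nonneg_nonpos[of "real s"]) (auto simp del: mult_le_0_iff)
      then show False using * fact_gt_zero[of r, where 'a = real] by linarith
    qed
    then show ?thesis using * by (simp add: L_def field_simps)
  qed
  \<comment> \<open>For small \<open>n\<close> the choice \<open>\<epsilon> n = - L\<close> makes the claimed lower bound equal to \<open>0\<close>.\<close>
  define \<epsilon> where "\<epsilon> n = (if 2 * r + 2 < n then min 0 (g n / \<beta> - L) else - L)" for n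
  have "\<epsilon> \<longlonglongrightarrow> 0"
  proof -
    \<comment> \<open>The factor \<open>6 / 5\<close> gained by the counting exceeds \<open>\<beta>\<close>, so the limit of \<open>g n / \<beta> - L\<close> is nonnegative.\<close>
    have "L * \<beta> \<le> real s / fact r * (6 / 5)" using L beta by (intro mult_mono) auto
    then have "L \<le> 6 * real s * (1 / fact r) * (1 / 5) / \<beta>" 
      using beta by (simp add: pos_le_divide_eq mult_ac)
    then have "(\<lambda>n. min 0 (g n / \<beta> - L)) \<longlonglongrightarrow> 0"
      using tendsto_min[OF tendsto_const tendsto_diff[OF tendsto_divide[OF lim_g tendsto_const[of \<beta>]] tendsto_const[of L]], of 0]
        beta by (simp add: min_absorb1)
    moreover have "\<forall>\<^sub>F n in sequentially. min 0 (g n / \<beta> - L) = \<epsilon> n"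
      by (rule eventually_sequentiallyI[of "2 * r + 3"]) (simp add: \<epsilon>_def)
    ultimately show ?thesis by (simp add: tendsto_cong)
  qed
  moreover have "\<beta> * (L + \<epsilon> n) * real n ^ (r - k) \<le> real (min_blocking x n)" for n
  proof (cases "2 * r + 2 < n")
    case True
    have "\<beta> * (L + \<epsilon> n) \<le> \<beta> * (g n / \<beta>)" using True beta by (intro mult_left_mono) (auto simp: \<epsilon>_def)
    also have "\<dots> = g n" using beta by simp
    finally have "\<beta> * (L + \<epsilon> n) * real n ^ (r - k) \<le> g n * real n ^ (r - k)"
      by (intro mult_right_mono) auto
    then show ?thesis using bound[OF True] by linarith
  qed (simp add: \<epsilon>_def)
  ultimately show ?thesis unfolding L_def \<beta>_def by blast
qed

end
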